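(* Let $(\mathfrak M,\Phi,\varphi)$ be a quantum dynamical system and let $(\mathfrak D_\infty,\Phi_\infty,\varphi_\infty)$ be its reversible part. Then: (i) $(\mathfrak M,\Phi,\varphi)$ is ergodic if and only if $(\mathfrak D_\infty,\Phi_\infty,\varphi_\infty)$ is ergodic; (ii) $(\mathfrak M,\Phi,\varphi)$ is weakly mixing if and only if $(\mathfrak D_\infty,\Phi_\infty,\varphi_\infty)$ is weakly mixing.
   Context: A unital Schwartz map on a von Neumann algebra $\mathfrak M$ is an ultraweakly continuous linear map $\Phi:\mathfrak M\to\mathfrak M$ with $\Phi(1)=1$ and $0\le\Phi(a^* )\Phi(a)\le\Phi(a^*a)$ for all $a\in\mathfrak M$. A quantum dynamical system $(\mathfrak M,\Phi,\varphi)$ consists of a von Neumann algebra $\mathfrak M$, a unital Schwartz map $\Phi$ on $\mathfrak M$, and a normal faithful state $\varphi$ on $\mathfrak M$ with $\varphi\circ\Phi=\varphi$, such that $\Phi$ admits a $\varphi$-adjoint, i.e. a normal unital Schwartz map $\Phi^\sharp:\mathfrak M\to\mathfrak M$ with $\varphi(b\Phi(a))=\varphi(\Phi^\sharp(b)a)$ for all $a,b\in\mathfrak M$. For a unital Schwartz map $\Psi$, its multiplicative domain is $\mathfrak D_\Psi=\{a\in\mathfrak M:\Psi(a^*a)=\Psi(a^* )\Psi(a)\text{ and }\Psi(aa^* )=\Psi(a)\Psi(a^* )\}$, a von Neumann algebra. For $k\in\mathbb Z$ put $\Phi_k=\Phi^k$ if $k\ge0$ and $\Phi_k=(\Phi^\sharp)^{|k|}$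 if $k<0$, and $\mathfrak D_\infty=\bigcap_{k\in\mathbb Z}\mathfrak D_{\Phi_k}$, a von Neumann subalgebra of $\mathfrak M$ on which $\Phi$ restricts to a $*$-automorphism. The reversible part of $(\mathfrak M,\Phi,\varphi)$ is $(\mathfrak D_\infty,\Phi_\infty,\varphi_\infty)$, where $\Phi_\infty$ and $\varphi_\infty$ are the restrictions of $\Phi$ and $\varphi$ to $\mathfrak D_\infty$. A quantum dynamical system $(\mathfrak M,\Phi,\varphi)$ is ergodic if for all $a,b\in\mathfrak M$, $\lim_{N\to\infty}\frac1{N+1}\sum_{k=0}^N[\varphi(a\Phi^k(b))-\varphi(a)\varphi(b)]=0$, and weakly mixing if for all $a,b\in\mathfrak M$, $\lim_{N\to\infty}\frac1{N+1}\sum_{k=0}^N|\varphi(a\Phi^k(b))-\varphi(a)\varphi(b)|=0$. *)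

theory Defs
  imports "HOL-Analysis.Analysis"
begin

section \<open>Complex Hilbert spaces\<close>

class complex_vector = real_vector +
  fixes scaleC :: "complex \<Rightarrow> 'a \<Rightarrow> 'a"  (infixr "*\<^sub>C" 75)
  assumes scaleC_of_real: "complex_of_real r *\<^sub>C x = r *\<^sub>R x"
    and scaleC_add_right: "c *\<^sub>C (x + y) = c *\<^sub>C x + c *\<^sub>C y"
    and scaleC_add_left: "(c + d) *\<^sub>C x = c *\<^sub>C x + d *\<^sub>C x"
    and scaleC_scaleC: "c *\<^sub>C d *\<^sub>C x = (c * d) *\<^sub>C x"

text \<open>The inner product is linear in the second argument. Positive definiteness is contained in
  \<open>cinner_self\<close>, completeness in \<^class>\<open>banach\<close>.\<close>

class chilbert_space = complex_vector + banach +
  fixes cinner :: "'a \<Rightarrow> 'a \<Rightarrow> complex"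
  assumes cinner_commute: "cinner x y = cnj (cinner y x)"
    and cinner_add_right: "cinner x (y + z) = cinner x y + cinner x z"
    and cinner_scaleC_right: "cinner x (c *\<^sub>C y) = c * cinner x y"
    and cinner_self: "cinner x x = complex_of_real ((norm x)\<^sup>2)"

lemma bounded_linear_scaleC: "bounded_linear (\<lambda>x::'h::chilbert_space. c *\<^sub>C x)"
proof (rule bounded_linear_intro)
  fix x y :: 'h and r :: real
  show "c *\<^sub>C (x + y) = c *\<^sub>C x + c *\<^sub>C y"
    by (rule scaleC_add_right)
  show "c *\<^sub>C (r *\<^sub>R x) = r *\<^sub>R (c *\<^sub>C x)"
    by (simp add: scaleC_scaleC mult.commute flip: scaleC_of_real)
  have "complex_of_real ((norm (c *\<^sub>C x))\<^sup>2) = c * cnj c * cinner x x"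
    by (metis cinner_commute cinner_scaleC_right cinner_self complex_cnj_mult mult.assoc mult.commute)
  also have "\<dots> = complex_of_real ((norm x * cmod c)\<^sup>2)"
    by (simp add: cinner_self power_mult_distrib flip: complex_norm_square)
  finally have "(norm (c *\<^sub>C x))\<^sup>2 = (norm x * cmod c)\<^sup>2"
    using of_real_eq_iff by blast
  then show "norm (c *\<^sub>C x) \<le> norm x * cmod c"
    by (simp add: power2_eq_iff_nonneg)
qed

section \<open>Bounded operators\<close>

definition bounded_clinear :: "('h::chilbert_space \<Rightarrow> 'h) \<Rightarrow> bool" where
  "bounded_clinear f \<longleftrightarrow> bounded_linear f \<and> (\<forall>c x. f (c *\<^sub>C x) = c *\<^sub>C f x)"

typedef (overloaded) 'h bop = "{f :: 'h::chilbert_space \<Rightarrow> 'h. bounded_clinear f}"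
  morphisms apply_op Abs_op
  by (rule exI[of _ id]) (auto simp: bounded_clinear_def id_def)

setup_lifting type_definition_bop

lemma bop_eqI: "(\<And>x. apply_op A x = apply_op B x) \<Longrightarrow> A = B"
  by (metis apply_op_inject ext)

instantiation bop :: (chilbert_space) "{zero, one, plus, minus, uminus, times}"
begin

lift_definition zero_bop :: "'a bop" is "\<lambda>x. 0"
  by (simp add: bounded_clinear_def linear_0[OF bounded_linear.linear[OF bounded_linear_scaleC]])

lift_definition one_bop :: "'a bop" is "\<lambda>x. x"
  by (simp add: bounded_clinear_def)

lift_definition plus_bop :: "'a bop \<Rightarrow> 'a bop \<Rightarrow> 'a bop" is "\<lambda>f g x. f x + g x"
  by (simp add: bounded_clinear_def bounded_linear_add scaleC_add_right)

lift_definition uminus_bop :: "'a bop \<Rightarrow> 'a bop" is "\<lambda>f x. - f x"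
  by (auto simp: bounded_clinear_def bounded_linear_minus
      linear_neg[OF bounded_linear.linear[OF bounded_linear_scaleC]])

lift_definition minus_bop :: "'a bop \<Rightarrow> 'a bop \<Rightarrow> 'a bop" is "\<lambda>f g x. f x - g x"
  by (auto simp: bounded_clinear_def bounded_linear_sub
      linear_diff[OF bounded_linear.linear[OF bounded_linear_scaleC]])

lift_definition times_bop :: "'a bop \<Rightarrow> 'a bop \<Rightarrow> 'a bop" is "\<lambda>f g x. f (g x)"
  by (auto simp: bounded_clinear_def intro: bounded_linear_compose)

instance ..

end

lemmas apply_op_simps =
  zero_bop.rep_eq one_bop.rep_eq plus_bop.rep_eq uminus_bop.rep_eq minus_bop.rep_eq times_bop.rep_eq

lemma bounded_linear_apply_op: "bounded_linear (apply_op A)"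
  using apply_op[of A] by (simp add: bounded_clinear_def)

lemma apply_op_scaleC: "apply_op A (c *\<^sub>C x) = c *\<^sub>C apply_op A x"
  using apply_op[of A] by (simp add: bounded_clinear_def)

instance bop :: (chilbert_space) "{ring, monoid_mult}"
  by standard
    (auto intro!: bop_eqI
      simp: apply_op_simps algebra_simps linear_add[OF bounded_linear.linear[OF bounded_linear_apply_op]])

instantiation bop :: (chilbert_space) complex_vector
begin

lift_definition scaleC_bop :: "complex \<Rightarrow> 'a bop \<Rightarrow> 'a bop" is "\<lambda>c f x. c *\<^sub>C f x"
  by (auto simp: bounded_clinear_def scaleC_scaleC mult.commute
      intro: bounded_linear_compose[OF bounded_linear_scaleC])

definition scaleR_bop :: "real \<Rightarrow> 'a bop \<Rightarrow> 'a bop" where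
  "scaleR_bop r A = complex_of_real r *\<^sub>C A"

instance
proof
  have 1: "1 *\<^sub>C x = x" for x :: 'a
    using scaleC_of_real[of 1 x] by simp
  fix A B :: "'a bop" and r s :: real and c d :: complex
  show "1 *\<^sub>R A = A"
    by (rule bop_eqI) (simp add: scaleR_bop_def scaleC_bop.rep_eq 1)
qed (auto intro!: bop_eqI
      simp: scaleR_bop_def scaleC_bop.rep_eq apply_op_simps scaleC_add_right scaleC_add_left
        scaleC_scaleC)

end

text \<open>The operator order: \<open>A \<le> B\<close> iff \<open>B - A\<close> is a positive operator.\<close>

instantiation bop :: (chilbert_space) ord
begin

definition less_eq_bop :: "'a bop \<Rightarrow> 'a bop \<Rightarrow> bool" where
  "A \<le> B \<longleftrightarrow> (\<forall>x. cinner x (apply_op (B - A) x) \<in> \<real>\<^sub>\<ge>\<^sub>0)"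

definition less_bop :: "'a bop \<Rightarrow> 'a bop \<Rightarrow> bool" where
  "A < B \<longleftrightarrow> A \<le> B \<and> \<not> B \<le> (A :: 'a bop)"

instance ..

end

definition adj :: "'h::chilbert_space bop \<Rightarrow> 'h bop" where
  "adj A = (THE B. \<forall>x y. cinner (apply_op B x) y = cinner x (apply_op A y))"

text \<open>The ultraweak topology is the coarsest one making all functionals
  \<open>A \<mapsto> (\<Sum>n. \<langle>\<xi> n, A (\<eta> n)\<rangle>)\<close> with square-summable sequences \<open>\<xi>\<close>, \<open>\<eta>\<close> continuous.\<close>

definition square_summable :: "(nat \<Rightarrow> 'h::chilbert_space) \<Rightarrow> bool" where
  "square_summable \<xi> \<longleftrightarrow> summable (\<lambda>n. (norm (\<xi> n))\<^sup>2)"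

definition vector_functional ::
    "(nat \<Rightarrow> 'h::chilbert_space) \<Rightarrow> (nat \<Rightarrow> 'h) \<Rightarrow> 'h bop \<Rightarrow> complex" where
  "vector_functional \<xi> \<eta> A = (\<Sum>n. cinner (\<xi> n) (apply_op A (\<eta> n)))"

definition ultraweak :: "'h::chilbert_space bop topology" where
  "ultraweak = topology_generated_by
     {vector_functional \<xi> \<eta> -` U | \<xi> \<eta> U. square_summable \<xi> \<and> square_summable \<eta> \<and> open U}"

section \<open>Von Neumann algebras, Schwartz maps and states\<close>

definition commutant :: "'h::chilbert_space bop set \<Rightarrow> 'h bop set" where
  "commutant S = {A. \<forall>B\<in>S. A * B = B * A}"

definition von_neumann_algebra :: "'h::chilbert_space bop set \<Rightarrow> bool" where
  "von_neumann_algebra M \<longleftrightarrow> (\<forall>a\<in>M. adj a \<in> M) \<and> commutant (commutant M) = M"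

text \<open>Maps and functionals on an algebra \<open>M\<close> are total HOL functions of which only the values on
  \<open>M\<close> matter.\<close>

definition clinear_on :: "'a::complex_vector set \<Rightarrow> ('a \<Rightarrow> 'b::complex_vector) \<Rightarrow> bool" where
  "clinear_on M f \<longleftrightarrow>
     (\<forall>a\<in>M. \<forall>b\<in>M. f (a + b) = f a + f b) \<and> (\<forall>c. \<forall>a\<in>M. f (c *\<^sub>C a) = c *\<^sub>C f a)"

instantiation complex :: complex_vector
begin

definition scaleC_complex :: "complex \<Rightarrow> complex \<Rightarrow> complex" where
  "scaleC_complex c z = c * z"

instance
  by standard (simp_all add: scaleC_complex_def algebra_simps scaleR_conv_of_real)

end

definition unital_schwartz_map ::
    "'h::chilbert_space bop set \<Rightarrow> ('h bop \<Rightarrow> 'h bop) \<Rightarrow> bool" where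
  "unital_schwartz_map M \<Phi> \<longleftrightarrow>
     \<Phi> \<in> M \<rightarrow> M \<and>
     clinear_on M \<Phi> \<and>
     continuous_map (subtopology ultraweak M) (subtopology ultraweak M) \<Phi> \<and>
     \<Phi> 1 = 1 \<and>
     (\<forall>a\<in>M. 0 \<le> \<Phi> (adj a) * \<Phi> a \<and> \<Phi> (adj a) * \<Phi> a \<le> \<Phi> (adj a * a))"

definition state_on :: "'h::chilbert_space bop set \<Rightarrow> ('h bop \<Rightarrow> complex) \<Rightarrow> bool" where
  "state_on M \<phi> \<longleftrightarrow> clinear_on M \<phi> \<and> (\<forall>a\<in>M. 0 \<le> a \<longrightarrow> \<phi> a \<in> \<real>\<^sub>\<ge>\<^sub>0) \<and> \<phi> 1 = 1"

definition normal_functional :: "'h::chilbert_space bop set \<Rightarrow> ('h bop \<Rightarrow> complex) \<Rightarrow> bool" where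
  "normal_functional M \<phi> \<longleftrightarrow> continuous_map (subtopology ultraweak M) euclidean \<phi>"

definition faithful :: "'h::chilbert_space bop set \<Rightarrow> ('h bop \<Rightarrow> complex) \<Rightarrow> bool" where
  "faithful M \<phi> \<longleftrightarrow> (\<forall>a\<in>M. \<phi> (adj a * a) = 0 \<longrightarrow> a = 0)"

section \<open>Quantum dynamical systems\<close>

definition is_state_adjoint ::
    "'h::chilbert_space bop set \<Rightarrow> ('h bop \<Rightarrow> 'h bop) \<Rightarrow> ('h bop \<Rightarrow> complex) \<Rightarrow>
     ('h bop \<Rightarrow> 'h bop) \<Rightarrow> bool" where
  "is_state_adjoint M \<Phi> \<phi> \<Psi> \<longleftrightarrow>
     unital_schwartz_map M \<Psi> \<and> (\<forall>a\<in>M. \<forall>b\<in>M. \<phi> (b * \<Phi> a) = \<phi> (\<Psi> b * a))"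

definition quantum_dynamical_system ::
    "'h::chilbert_space bop set \<Rightarrow> ('h bop \<Rightarrow> 'h bop) \<Rightarrow> ('h bop \<Rightarrow> complex) \<Rightarrow> bool" where
  "quantum_dynamical_system M \<Phi> \<phi> \<longleftrightarrow>
     von_neumann_algebra M \<and>
     unital_schwartz_map M \<Phi> \<and>
     state_on M \<phi> \<and> normal_functional M \<phi> \<and> faithful M \<phi> \<and>
     (\<forall>a\<in>M. \<phi> (\<Phi> a) = \<phi> a) \<and>
     (\<exists>\<Psi>. is_state_adjoint M \<Phi> \<phi> \<Psi>)"

text \<open>Since \<open>\<phi>\<close> is faithful, the values of the adjoint on \<open>M\<close> do not depend on the choice.\<close>

definition state_adjoint ::
    "'h::chilbert_space bop set \<Rightarrow> ('h bop \<Rightarrow> 'h bop) \<Rightarrow> ('h bop \<Rightarrow> complex) \<Rightarrow>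
     'h bop \<Rightarrow> 'h bop" where
  "state_adjoint M \<Phi> \<phi> = (SOME \<Psi>. is_state_adjoint M \<Phi> \<phi> \<Psi>)"

definition multiplicative_domain ::
    "'h::chilbert_space bop set \<Rightarrow> ('h bop \<Rightarrow> 'h bop) \<Rightarrow> 'h bop set" where
  "multiplicative_domain M \<Psi> =
     {a \<in> M. \<Psi> (adj a * a) = \<Psi> (adj a) * \<Psi> a \<and> \<Psi> (a * adj a) = \<Psi> a * \<Psi> (adj a)}"

definition int_iterate ::
    "'h::chilbert_space bop set \<Rightarrow> ('h bop \<Rightarrow> 'h bop) \<Rightarrow> ('h bop \<Rightarrow> complex) \<Rightarrow>
     int \<Rightarrow> 'h bop \<Rightarrow> 'h bop" where
  "int_iterate M \<Phi> \<phi> k =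
     (if k \<ge> 0 then \<Phi> ^^ nat k else state_adjoint M \<Phi> \<phi> ^^ nat \<bar>k\<bar>)"

definition reversible_algebra ::
    "'h::chilbert_space bop set \<Rightarrow> ('h bop \<Rightarrow> 'h bop) \<Rightarrow> ('h bop \<Rightarrow> complex) \<Rightarrow> 'h bop set" where
  "reversible_algebra M \<Phi> \<phi> = (\<Inter>k::int. multiplicative_domain M (int_iterate M \<Phi> \<phi> k))"

definition reversible_map ::
    "'h::chilbert_space bop set \<Rightarrow> ('h bop \<Rightarrow> 'h bop) \<Rightarrow> ('h bop \<Rightarrow> complex) \<Rightarrow>
     'h bop \<Rightarrow> 'h bop" where
  "reversible_map M \<Phi> \<phi> = restrict \<Phi> (reversible_algebra M \<Phi> \<phi>)"

definition reversible_state ::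
    "'h::chilbert_space bop set \<Rightarrow> ('h bop \<Rightarrow> 'h bop) \<Rightarrow> ('h bop \<Rightarrow> complex) \<Rightarrow>
     'h bop \<Rightarrow> complex" where
  "reversible_state M \<Phi> \<phi> = restrict \<phi> (reversible_algebra M \<Phi> \<phi>)"

definition ergodic ::
    "'h::chilbert_space bop set \<Rightarrow> ('h bop \<Rightarrow> 'h bop) \<Rightarrow> ('h bop \<Rightarrow> complex) \<Rightarrow> bool" where
  "ergodic M \<Phi> \<phi> \<longleftrightarrow>
     (\<forall>a\<in>M. \<forall>b\<in>M.
       (\<lambda>N. 1 / of_nat (N + 1) * (\<Sum>k=0..N. \<phi> (a * (\<Phi> ^^ k) b) - \<phi> a * \<phi> b)) \<longlonglongrightarrow> 0)"

definition weakly_mixing ::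
    "'h::chilbert_space bop set \<Rightarrow> ('h bop \<Rightarrow> 'h bop) \<Rightarrow> ('h bop \<Rightarrow> complex) \<Rightarrow> bool" where
  "weakly_mixing M \<Phi> \<phi> \<longleftrightarrow>
     (\<forall>a\<in>M. \<forall>b\<in>M.
       (\<lambda>N. 1 / real (N + 1) * (\<Sum>k=0..N. cmod (\<phi> (a * (\<Phi> ^^ k) b) - \<phi> a * \<phi> b))) \<longlonglongrightarrow> 0)"

end

theory Submission imports Defs begin

text \<open>
  Everything takes place in \<open>M\<close> with the seminorm \<open>q a = \<phi>(a\<^sup>*a)\<^bsup>1/2\<^esup>\<close>, for which \<open>\<Phi>\<close> and its
  adjoint \<open>\<Phi>\<^sup>\<sharp>\<close> are mutually adjoint contractions. An element lies in the multiplicative domain of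
  \<open>\<Phi>\<^sup>k\<close> iff it is fixed by \<open>(\<Phi>\<^sup>\<sharp>)\<^sup>k\<Phi>\<^sup>k\<close>, so the reversible algebra is the unitary part of
  \<open>\<Phi>\<close>. Orbits are norm bounded, hence have ultraweak cluster points in \<open>M\<close>, and since \<open>q(\<Phi>\<^sup>n a)\<close>
  decreases, these cluster points are reversible.

  A cluster point of the ergodic averages of \<open>b\<close> is a fixed point, hence reversible, hence the scalar
  \<open>\<phi>(b)\<close> if the reversible part is ergodic. For weak mixing, \<open>b\<close> is written as a reversible element plus
  a remainder almost orthogonal to the reversible algebra; the cluster points of the orbit of the
  remainder are reversible and almost orthogonal to themselves, so the remainder is negligible. This
  replaces the conditional expectation onto the reversible algebra.
\<close>

section \<open>Positive sesquilinear forms\<close>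

text \<open>The order is defined by quadratic forms, so a positive element does not come as
  \<open>adj b * b\<close>, and the Schwarz inequality does not directly show that a Schwartz map is
  positive or norm contractive. Contractivity is therefore obtained first, from repeated squaring
  and ultraweak continuity, and positivity is derived from it by passing to \<open>C - a\<close>.
  Positivity is what makes composites of Schwartz maps Schwartz maps again; contractivity is what
  keeps orbits bounded. The space is not completed for \<open>q\<close>, because a limit in the
  completion need not come from an element of \<open>M\<close>. Limits are ultraweak instead, and
  two limits are compared by pairing them with elements of \<open>M\<close>. The price of working
  without a completion is that projections onto the reversible algebra exist only up to an error,
  which is carried along and sent to zero at the end.\<close>

lemma scaleC_one [simp]: "1 *\<^sub>C x = (x :: 'a::complex_vector)"
  using scaleC_of_real[of 1 x] by simp

lemma scaleC_minus_one: "(-1) *\<^sub>C x = - (x :: 'a::complex_vector)"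
  using scaleC_of_real[of "-1" x] by simp

text \<open>One Cauchy-Schwarz argument serves five kinds of forms: the inner product,
  \<open>\<langle>x, A y\<rangle>\<close> for a positive operator, \<open>\<Psi> (adj x * y)\<close>
  and the multiplicativity defect of \<open>\<Psi>\<close>, both evaluated at a vector, and
  \<open>\<phi> (adj x * y)\<close>. The carrier \<open>S\<close> is there because the last three
  live on the algebra.\<close>

locale positive_form =
  fixes S :: "'a::complex_vector set" and B :: "'a \<Rightarrow> 'a \<Rightarrow> complex"
  assumes add_closed: "\<lbrakk>x \<in> S; y \<in> S\<rbrakk> \<Longrightarrow> x + y \<in> S"
    and scale_closed: "x \<in> S \<Longrightarrow> c *\<^sub>C x \<in> S"
    and add_right: "\<lbrakk>x \<in> S; y \<in> S; z \<in> S\<rbrakk> \<Longrightarrow> B x (y + z) = B x y + B x z"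
    and add_left: "\<lbrakk>x \<in> S; y \<in> S; z \<in> S\<rbrakk> \<Longrightarrow> B (x + y) z = B x z + B y z"
    and scale_right: "\<lbrakk>x \<in> S; y \<in> S\<rbrakk> \<Longrightarrow> B x (c *\<^sub>C y) = c * B x y"
    and scale_left: "\<lbrakk>x \<in> S; y \<in> S\<rbrakk> \<Longrightarrow> B (c *\<^sub>C x) y = cnj c * B x y"
    and nonneg: "x \<in> S \<Longrightarrow> B x x \<in> \<real>\<^sub>\<ge>\<^sub>0"
begin

definition seminorm :: "'a \<Rightarrow> real" where
  "seminorm x = sqrt (Re (B x x))"

lemma diff_closed: "\<lbrakk>x \<in> S; y \<in> S\<rbrakk> \<Longrightarrow> x - y \<in> S"
  using add_closed[of x "(-1) *\<^sub>C y"] scale_closed[of y "-1"] by (simp add: scaleC_minus_one)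

lemma diff_right: "\<lbrakk>x \<in> S; y \<in> S; z \<in> S\<rbrakk> \<Longrightarrow> B x (y - z) = B x y - B x z"
  using add_right[of x y "(-1) *\<^sub>C z"] scale_closed[of z "-1"] scale_right[of x z "-1"]
  by (simp add: scaleC_minus_one)

lemma diff_left: "\<lbrakk>x \<in> S; y \<in> S; z \<in> S\<rbrakk> \<Longrightarrow> B (x - y) z = B x z - B y z"
  using add_left[of x "(-1) *\<^sub>C y" z] scale_closed[of y "-1"] scale_left[of y z "-1"]
  by (simp add: scaleC_minus_one)

lemma Re_nonneg: "x \<in> S \<Longrightarrow> 0 \<le> Re (B x x)"
  and Im_zero: "x \<in> S \<Longrightarrow> Im (B x x) = 0"
  using nonneg[of x] by (simp_all add: complex_nonneg_Reals_iff)

text \<open>Polarization: \<open>B z z\<close> is real, so \<open>z = x + y\<close> makes the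
  imaginary parts of \<open>B x y\<close> and \<open>B y x\<close> opposite, and
  \<open>z = x + \<i> *\<^sub>C y\<close> makes their real parts equal.\<close>

lemma hermitian:
  assumes "x \<in> S" "y \<in> S"
  shows "B y x = cnj (B x y)"
proof -
  have iy: "\<i> *\<^sub>C y \<in> S"
    using assms scale_closed by blast
  have "Im (B (x + y) (x + y)) = Im (B x y) + Im (B y x)"
    using assms by (simp add: add_left add_right add_closed Im_zero)
  then have 1: "Im (B x y) + Im (B y x) = 0"
    using Im_zero[OF add_closed] assms by simp
  have "B (x + \<i> *\<^sub>C y) (x + \<i> *\<^sub>C y) = B x x + \<i> * B x y - \<i> * B y x + B y y"
    using assms iy by (simp add: add_left add_right add_closed scale_left scale_right algebra_simps)
  then have "Re (B x y) - Re (B y x) = 0"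
    using Im_zero[OF add_closed, OF assms(1) iy] assms by (simp add: Im_zero)
  with 1 show ?thesis
    by (simp add: complex_eq_iff)
qed

lemma form_self: "x \<in> S \<Longrightarrow> B x x = complex_of_real ((seminorm x)\<^sup>2)"
  by (simp add: complex_eq_iff Im_zero seminorm_def Re_nonneg)

lemma seminorm_nonneg [simp]: "x \<in> S \<Longrightarrow> 0 \<le> seminorm x"
  by (simp add: seminorm_def Re_nonneg)

lemma seminorm_add_scale:
  assumes "x \<in> S" "y \<in> S"
  shows "(seminorm (x + c *\<^sub>C y))\<^sup>2 =
    (seminorm x)\<^sup>2 + 2 * Re (c * B x y) + (cmod c)\<^sup>2 * (seminorm y)\<^sup>2"
proof -
  have cy: "c *\<^sub>C y \<in> S"
    using assms scale_closed by blast
  have "complex_of_real ((seminorm (x + c *\<^sub>C y))\<^sup>2) =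
      B x x + (c * B x y + cnj (c * B x y)) + (c * cnj c) * B y y"
    using assms cy hermitian[OF assms] add_closed[OF assms(1) cy]
    by (simp add: add_left add_right scale_left scale_right algebra_simps form_self[symmetric]
        del: of_real_power)
  also have "\<dots> = complex_of_real
      ((seminorm x)\<^sup>2 + 2 * Re (c * B x y) + (cmod c)\<^sup>2 * (seminorm y)\<^sup>2)"
    using assms by (simp add: form_self complex_add_cnj complex_norm_square[symmetric]
        del: complex_cnj_mult)
  finally show ?thesis
    using of_real_eq_iff by blast
qed

text \<open>Positivity at \<open>x - t * cnj b *\<^sub>C y\<close> for real \<open>t\<close>, where
  \<open>b = B x y\<close>. The best \<open>t\<close> is \<open>1 / (seminorm y)\<^sup>2\<close>;
  for degenerate \<open>y\<close> the bound is affine in \<open>t\<close>, and a large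
  \<open>t\<close> excludes \<open>b \<noteq> 0\<close>.\<close>

lemma cauchy_schwarz:
  assumes "x \<in> S" "y \<in> S"
  shows "cmod (B x y) \<le> seminorm x * seminorm y"
proof -
  define b where "b = B x y"
  have key: "0 \<le> (seminorm x)\<^sup>2 - 2 * t * (cmod b)\<^sup>2 + t\<^sup>2 * (cmod b)\<^sup>2 * (seminorm y)\<^sup>2" for t :: real
  proof -
    have "(- complex_of_real t * cnj b) * b = - complex_of_real (t * (cmod b)\<^sup>2)"
      using complex_norm_square[of b] by (simp only: of_real_mult) (simp add: mult.commute)
    then have "Re ((- complex_of_real t * cnj b) * b) = - (t * (cmod b)\<^sup>2)"
      by (metis Re_complex_of_real uminus_complex.sel(1))
    then show ?thesis
      using seminorm_add_scale[OF assms, of "- complex_of_real t * cnj b"]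
        zero_le_power2[of "seminorm (x + (- complex_of_real t * cnj b) *\<^sub>C y)"]
      by (simp add: norm_mult power_mult_distrib flip: b_def)
  qed
  have "(cmod b)\<^sup>2 \<le> (seminorm x)\<^sup>2 * (seminorm y)\<^sup>2"
  proof (cases "seminorm y = 0")
    case True
    show ?thesis
    proof (cases "b = 0")
      case False
      then have "0 \<le> (seminorm x)\<^sup>2 - 2 * (((seminorm x)\<^sup>2 + 1) / (cmod b)\<^sup>2) * (cmod b)\<^sup>2"
        using key[of "((seminorm x)\<^sup>2 + 1) / (cmod b)\<^sup>2"] True by simp
      also have "\<dots> = - (seminorm x)\<^sup>2 - 2"
        using False by (simp add: field_simps)
      finally show ?thesis
        using zero_le_power2[of "seminorm x"] by linarith
    qed simp
  next
    case False
    have "0 \<le> (seminorm x)\<^sup>2 - (cmod b)\<^sup>2 / (seminorm y)\<^sup>2"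
      using key[of "1 / (seminorm y)\<^sup>2"] False by (simp add: field_simps power2_eq_square)
    then show ?thesis
      using False by (simp add: field_simps)
  qed
  then have "(cmod b)\<^sup>2 \<le> (seminorm x * seminorm y)\<^sup>2"
    by (simp add: power_mult_distrib)
  then show ?thesis
    using assms b_def power2_le_imp_le by auto
qed

lemma seminorm_diff_sq:
  assumes "x \<in> S" "y \<in> S"
  shows "(seminorm (x - y))\<^sup>2 = (seminorm x)\<^sup>2 - 2 * Re (B x y) + (seminorm y)\<^sup>2"
  using seminorm_add_scale[OF assms, of "-1"] by (simp add: scaleC_minus_one)

lemma seminorm_scale: "x \<in> S \<Longrightarrow> seminorm (c *\<^sub>C x) = cmod c * seminorm x"
proof -
  assume x: "x \<in> S"
  then have "B (c *\<^sub>C x) (c *\<^sub>C x) = (c * cnj c) * B x x"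
    by (simp add: scale_left scale_right scale_closed)
  also have "\<dots> = complex_of_real ((cmod c)\<^sup>2) * B x x"
    by (simp only: complex_norm_square)
  finally have "Re (B (c *\<^sub>C x) (c *\<^sub>C x)) = (cmod c)\<^sup>2 * Re (B x x)"
    by (simp only: Re_complex_of_real times_complex.sel Im_complex_of_real)
  then show ?thesis
    by (simp add: seminorm_def real_sqrt_mult)
qed

lemma seminorm_triangle_diff:
  assumes "x \<in> S" "y \<in> S"
  shows "seminorm (x - y) \<le> seminorm x + seminorm y"
proof (rule power2_le_imp_le)
  have "- Re (B x y) \<le> seminorm x * seminorm y"
    using cauchy_schwarz[OF assms] abs_Re_le_cmod[of "B x y"] by linarith
  then show "(seminorm (x - y))\<^sup>2 \<le> (seminorm x + seminorm y)\<^sup>2"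
    by (simp add: seminorm_diff_sq assms power2_sum)
qed (use assms in simp)

text \<open>A substitute for the orthogonal projection onto the closure of \<open>D\<close>, which avoids completing
  the space.\<close>

lemma near_projection:
  assumes D: "D \<subseteq> S" "D \<noteq> {}" "\<And>x y. \<lbrakk>x \<in> D; y \<in> D\<rbrakk> \<Longrightarrow> x + y \<in> D"
      "\<And>c x. x \<in> D \<Longrightarrow> c *\<^sub>C x \<in> D"
    and x: "x \<in> S" and \<epsilon>: "\<epsilon> > 0"
  obtains e where "e \<in> D" "\<And>f. f \<in> D \<Longrightarrow> cmod (B f (x - e)) \<le> \<epsilon> * seminorm f"
proof -
  define X where "X = (\<lambda>e. (seminorm (x - e))\<^sup>2) ` D"
  have bdd: "bdd_below X"
    unfolding X_def by (rule bdd_belowI[of _ 0]) auto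
  have "X \<noteq> {}"
    using D(2) X_def by auto
  then have "\<exists>z\<in>X. z < Inf X + \<epsilon>\<^sup>2"
    using \<epsilon> cInf_lessD[of X "Inf X + \<epsilon>\<^sup>2"] by auto
  then obtain e where e: "e \<in> D" "(seminorm (x - e))\<^sup>2 < Inf X + \<epsilon>\<^sup>2"
    unfolding X_def by blast
  show thesis
  proof (rule that[OF e(1)])
    fix f assume f: "f \<in> D"
    then have S: "f \<in> S" "x - e \<in> S"
      using D(1) x e(1) diff_closed by auto
    define b where "b = B (x - e) f"
    have bf: "B f (x - e) = cnj b"
      using hermitian[OF S(2,1)] b_def by simp
    show "cmod (B f (x - e)) \<le> \<epsilon> * seminorm f"
    proof (cases "seminorm f = 0")
      case True
      then show ?thesis
        using cauchy_schwarz[OF S] by simp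
    next
      case False
      \<comment> \<open>The best correction of \<open>e\<close> along \<open>f\<close>: it lowers
        the squared distance to \<open>x\<close> by
        \<open>(cmod b)\<^sup>2 / (seminorm f)\<^sup>2\<close>, which cannot exceed the slack
        \<open>\<epsilon>\<^sup>2\<close> left in the choice of \<open>e\<close>.\<close>
      define c where "c = - cnj b / complex_of_real ((seminorm f)\<^sup>2)"
      have "x - (e - c *\<^sub>C f) = x - e + c *\<^sub>C f"
        by simp
      moreover have "e - c *\<^sub>C f \<in> D"
        using D(3)[OF e(1) D(4)[OF f, of "- c"]] scaleC_scaleC[of "-1" c f]
        by (metis add_uminus_conv_diff mult_minus1 scaleC_minus_one)
      ultimately have "(seminorm (x - e + c *\<^sub>C f))\<^sup>2 \<in> X"
        unfolding X_def by (metis image_eqI)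
      then have "Inf X \<le> (seminorm (x - e + c *\<^sub>C f))\<^sup>2"
        using bdd by (simp add: cInf_lower)
      also have "\<dots> = (seminorm (x - e))\<^sup>2 + 2 * Re (c * b) + (cmod c)\<^sup>2 * (seminorm f)\<^sup>2"
        using seminorm_add_scale[OF S(2,1)] b_def by simp
      also have "c * b = - complex_of_real ((cmod b)\<^sup>2 / (seminorm f)\<^sup>2)"
        using complex_norm_square[of b] by (simp add: c_def mult.commute)
      also have "(cmod c)\<^sup>2 * (seminorm f)\<^sup>2 = (cmod b)\<^sup>2 / (seminorm f)\<^sup>2"
        using False by (simp add: c_def norm_divide norm_mult power_divide power2_eq_square)
      finally have "(cmod b)\<^sup>2 / (seminorm f)\<^sup>2 \<le> \<epsilon>\<^sup>2"
        using e(2) by simp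
      then have "(cmod b)\<^sup>2 \<le> (\<epsilon> * seminorm f)\<^sup>2"
        using False by (simp add: field_simps)
      then have "cmod b \<le> \<epsilon> * seminorm f"
        using \<epsilon> S power2_le_imp_le by (metis less_imp_le mult_nonneg_nonneg seminorm_nonneg)
      then show ?thesis
        by (simp add: bf)
    qed
  qed
qed

end

section \<open>Hilbert space operators\<close>

lemma cinner_add_left: "cinner (x + y) z = cinner x z + cinner y z"
  by (metis cinner_commute cinner_add_right complex_cnj_add)

lemma cinner_scaleC_left: "cinner (c *\<^sub>C x) y = cnj c * cinner x y"
  by (metis cinner_commute cinner_scaleC_right complex_cnj_mult)

interpretation cinner: positive_form "UNIV :: 'h::chilbert_space set" cinner
  rewrites "positive_form.seminorm cinner = (norm :: 'h \<Rightarrow> real)"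
proof -
  show 1: "positive_form (UNIV :: 'h set) cinner"
    by unfold_locales
      (auto simp: cinner_add_left cinner_add_right cinner_scaleC_left cinner_scaleC_right
        cinner_self)
  show "positive_form.seminorm cinner = (norm :: 'h \<Rightarrow> real)"
    by (simp add: positive_form.seminorm_def[OF 1] cinner_self fun_eq_iff)
qed

lemmas cinner_diff_right = cinner.diff_right[simplified]
  and cinner_diff_left = cinner.diff_left[simplified]
  and norm_scaleC = cinner.seminorm_scale[simplified]
  and cmod_cinner_le = cinner.cauchy_schwarz[simplified]

lemma cinner_zero_right [simp]: "cinner x 0 = 0"
  using cinner_diff_right[of x 0 0] by simp

lemma cinner_zero_left [simp]: "cinner 0 x = 0"
  using cinner_diff_left[of 0 0 x] by simp

lemma cinner_eqI: "(\<And>x. cinner x y = cinner x z) \<Longrightarrow> y = z"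
  using cinner_self[of "y - z"] cinner_diff_right[of "y - z" y z] by simp

section \<open>Riesz representation and operators given by bounded forms\<close>

lemma parallelogram:
  "(norm (x - y))\<^sup>2 = 2 * (norm x)\<^sup>2 + 2 * (norm y)\<^sup>2 - 4 * (norm ((1/2) *\<^sub>R (x + y)))\<^sup>2"
  for x y :: "'h::chilbert_space"
  using cinner.seminorm_add_scale[of x y 1] cinner.seminorm_diff_sq[of x y]
  by (simp add: power_mult_distrib power_divide del: scaleR_right_distrib) (simp add: field_simps)

text \<open>Variational proof: \<open>z\<close> minimizes \<open>J\<close>. The parallelogram
  identity makes a minimizing sequence Cauchy, the first variation at \<open>z\<close> gives
  equality of real parts, and replacing \<open>x\<close> by \<open>\<i> *\<^sub>C x\<close> gives
  the imaginary parts.\<close>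

lemma riesz_representation:
  fixes f :: "'h::chilbert_space \<Rightarrow> complex"
  assumes add: "\<And>x y. f (x + y) = f x + f y"
    and scale: "\<And>c x. f (c *\<^sub>C x) = c * f x"
    and bound: "\<And>x. cmod (f x) \<le> C * norm x"
  obtains z where "\<And>x. f x = cinner z x"
proof -
  have scaleR: "f (r *\<^sub>R x) = of_real r * f x" for r x
    using scale by (metis scaleC_of_real)
  have blf: "bounded_linear f"
    by (rule bounded_linear_intro[where K = C])
      (auto simp: add scaleR scaleR_conv_of_real mult.commute[of "norm _"] bound)
  define J where "J x = (norm x)\<^sup>2 - 2 * Re (f x)" for x
  have "J x \<ge> - C\<^sup>2" for x
  proof -
    have "Re (f x) \<le> C * norm x"
      using bound[of x] complex_Re_le_cmod[of "f x"] by linarith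
    moreover have "0 \<le> (norm x - C)\<^sup>2"
      by simp
    ultimately show ?thesis
      by (simp add: J_def power2_diff algebra_simps)
  qed
  then have bdd: "bdd_below (range J)"
    by (auto intro!: bdd_belowI)
  define m where "m = Inf (range J)"
  have m: "m \<le> J x" for x
    using bdd by (simp add: cInf_lower m_def)
  have "\<exists>x. J x < m + inverse (real (Suc n))" for n
    using cInf_lessD[of "range J" "m + inverse (real (Suc n))"] by (auto simp: m_def)
  then obtain u where u: "J (u n) < m + inverse (real (Suc n))" for n
    by metis
  have est: "(norm (u k - u l))\<^sup>2 \<le> 4 * inverse (real (Suc n))" if "n \<le> k" "n \<le> l" for k l n
  proof -
    have "(norm (u k - u l))\<^sup>2 = 2 * J (u k) + 2 * J (u l) - 4 * J ((1/2) *\<^sub>R (u k + u l))"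
      unfolding J_def parallelogram by (simp add: scaleR add field_simps)
    moreover have "inverse (real (Suc k)) \<le> inverse (real (Suc n))"
      "inverse (real (Suc l)) \<le> inverse (real (Suc n))"
      using that by (auto simp: field_simps)
    ultimately show ?thesis
      using u[of k] u[of l] m[of "(1/2) *\<^sub>R (u k + u l)"] by linarith
  qed
  have "Cauchy u"
  proof (rule metric_CauchyI)
    fix e :: real assume "e > 0"
    then obtain n where n: "inverse (real (Suc n)) < e\<^sup>2 / 4"
      using reals_Archimedean[of "e\<^sup>2 / 4"] by auto
    have "dist (u k) (u l) < e" if "n \<le> k" "n \<le> l" for k l
    proof (rule power2_less_imp_less)
      show "(dist (u k) (u l))\<^sup>2 < e\<^sup>2"
        using est[OF that] n by (simp add: dist_norm)
    qed (use \<open>e > 0\<close> in simp)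
    then show "\<exists>M. \<forall>k\<ge>M. \<forall>l\<ge>M. dist (u k) (u l) < e"
      by blast
  qed
  then obtain z where z: "u \<longlonglongrightarrow> z"
    using Cauchy_convergent convergent_def by blast
  have "(\<lambda>n. J (u n)) \<longlonglongrightarrow> J z"
    unfolding J_def by (intro tendsto_intros bounded_linear.tendsto[OF blf] z)
  moreover have "(\<lambda>n. m + inverse (real (Suc n))) \<longlonglongrightarrow> m + 0"
    by (intro tendsto_intros LIMSEQ_inverse_real_of_nat)
  ultimately have "J z \<le> m + 0"
    using u by (intro LIMSEQ_le[where X = "\<lambda>n. J (u n)"]) (auto intro: less_imp_le)
  then have Jz: "J z \<le> J x" for x
    using m[of x] by simp
  have Re: "Re (cinner z y) = Re (f y)" for y
  proof -
    define d where "d = Re (cinner z y) - Re (f y)"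
    have key: "0 \<le> 2 * t * d + t\<^sup>2 * (norm y)\<^sup>2" for t :: real
      using Jz[of "z + complex_of_real t *\<^sub>C y"] cinner.seminorm_add_scale[of z y "complex_of_real t"]
      by (simp add: J_def d_def add scale algebra_simps)
    show ?thesis
    proof (rule ccontr)
      assume "\<not> ?thesis"
      then have d: "d \<noteq> 0"
        by (simp add: d_def)
      \<comment> \<open>A step against the sign of \<open>d\<close>, short enough for the linear
        term to win; the added 1 keeps the denominator positive when \<open>y = 0\<close>.\<close>
      define t where "t = - d / ((norm y)\<^sup>2 + 1)"
      have pos: "(norm y)\<^sup>2 + 1 > 0"
        by (simp add: add_nonneg_pos)
      have "2 * t * d + t\<^sup>2 * (norm y)\<^sup>2 = - (d\<^sup>2 / ((norm y)\<^sup>2 + 1)) * (2 - (norm y)\<^sup>2 / ((norm y)\<^sup>2 + 1))"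
        using pos by (simp add: t_def power2_eq_square divide_simps) (simp add: algebra_simps)
      moreover have "(norm y)\<^sup>2 / ((norm y)\<^sup>2 + 1) < 1"
        using pos by simp
      moreover have "d\<^sup>2 / ((norm y)\<^sup>2 + 1) > 0"
        using d pos by simp
      ultimately have "2 * t * d + t\<^sup>2 * (norm y)\<^sup>2 < 0"
        by (simp only: mult_less_0_iff) simp
      then show False
        using key[of t] by simp
    qed
  qed
  have "f x = cinner z x" for x
    using Re[of x] Re[of "\<i> *\<^sub>C x"]
    by (simp add: complex_eq_iff cinner_scaleC_right scale)
  then show thesis
    by (rule that)
qed

lemma apply_op_add: "apply_op A (x + y) = apply_op A x + apply_op A y"
  and apply_op_zero [simp]: "apply_op A 0 = 0"
  using bounded_linear.linear[OF bounded_linear_apply_op[of A]]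
  by (auto simp: linear_add linear_0)

text \<open>Riesz is applied to the conjugate of the form in its first variable. This is the source
  both of adjoints and of operators obtained as limits of matrix coefficients.\<close>

lemma bop_of_form:
  fixes g :: "'h::chilbert_space \<Rightarrow> 'h \<Rightarrow> complex"
  assumes addR: "\<And>x y z. g x (y + z) = g x y + g x z"
    and addL: "\<And>x y z. g (x + y) z = g x z + g y z"
    and scaleR: "\<And>c x y. g x (c *\<^sub>C y) = c * g x y"
    and scaleL: "\<And>c x y. g (c *\<^sub>C x) y = cnj c * g x y"
    and bound: "\<And>x y. cmod (g x y) \<le> C * norm x * norm y"
  obtains A where "\<And>x y. cinner x (apply_op A y) = g x y"
    "\<And>x. norm (apply_op A x) \<le> C * norm x"
proof -
  have "\<exists>z. \<forall>x. cinner x z = g x y" for y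
  proof -
    obtain z where "\<And>x. cnj (g x y) = cinner z x"
    proof (rule riesz_representation[of "\<lambda>x. cnj (g x y)" "C * norm y"])
      show "cmod (cnj (g x y)) \<le> C * norm y * norm x" for x
        using bound[of x y] by (simp add: mult.commute mult.left_commute)
    qed (auto simp: addL scaleL)
    then show ?thesis
      by (metis cinner_commute complex_cnj_cnj)
  qed
  then obtain h where h: "\<And>x y. cinner x (h y) = g x y"
    by metis
  have hb: "norm (h x) \<le> C * norm x" for x
  proof (cases "h x = 0")
    case True
    \<comment> \<open>\<open>C\<close> carries no sign condition; the bound on the diagonal supplies
      \<open>0 \<le> C * norm x\<close>.\<close>
    have "cmod (g x x) \<le> C * norm x * norm x"
      by (rule bound)
    then have "0 \<le> (C * norm x) * norm x"
      by (rule order_trans[OF norm_ge_zero])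
    then show ?thesis
      using True by (cases "x = 0") (auto simp: zero_le_mult_iff)
  next
    case False
    have "norm (h x) * norm (h x) = cmod (g (h x) x)"
      using arg_cong[OF h[of "h x" x], of cmod]
      by (simp add: cinner_self power2_eq_square norm_mult)
    also have "\<dots> \<le> C * norm x * norm (h x)"
      using bound[of "h x" x] by (simp add: mult.commute mult.left_commute)
    finally show ?thesis
      using False by simp
  qed
  have add: "h (x + y) = h x + h y" for x y
    by (rule cinner_eqI) (simp add: h addR cinner_add_right)
  have scale: "h (c *\<^sub>C x) = c *\<^sub>C h x" for c x
    by (rule cinner_eqI) (simp add: h scaleR cinner_scaleC_right)
  have "bounded_clinear h"
    unfolding bounded_clinear_def
  proof
    show "bounded_linear h"
      by (rule bounded_linear_intro[where K = C])
        (auto simp: add scale hb mult.commute[of "norm _"] simp flip: scaleC_of_real)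
  qed (simp add: scale)
  then have "apply_op (Abs_op h) = h"
    by (simp add: Abs_op_inverse)
  then show thesis
    using that[of "Abs_op h"] h hb by simp
qed

section \<open>Adjoints\<close>

lemma bop_bounded:
  obtains C where "C \<ge> 0" "\<And>x. norm (apply_op A x) \<le> C * norm x"
  using bounded_linear.nonneg_bounded[OF bounded_linear_apply_op[of A]] by (metis mult.commute)

text \<open>\<open>adj\<close> is a definite description, so existence and uniqueness are settled
  here once; existence comes from the bounded form \<open>cinner (apply_op A x) y\<close>.\<close>

lemma cinner_adj_left: "cinner (apply_op (adj A) x) y = cinner x (apply_op A y)"
proof -
  obtain C where C: "C \<ge> 0" "\<And>x. norm (apply_op A x) \<le> C * norm x"
    using bop_bounded by blast
  obtain B where "\<And>x y. cinner x (apply_op B y) = cinner (apply_op A x) y"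
  proof (rule bop_of_form[of "\<lambda>x y. cinner (apply_op A x) y" C])
    show "cmod (cinner (apply_op A x) y) \<le> C * norm x * norm y" for x y
      using cmod_cinner_le[of "apply_op A x" y] mult_right_mono[OF C(2)[of x], of "norm y"]
      by simp
  qed (auto simp: cinner_add_right cinner_add_left cinner_scaleC_right cinner_scaleC_left
      apply_op_add apply_op_scaleC)
  then have B: "\<forall>x y. cinner (apply_op B x) y = cinner x (apply_op A y)"
    by (metis cinner_commute)
  have "adj A = B"
    unfolding adj_def
  proof (rule the_equality[of _ B])
    fix B' assume "\<forall>x y. cinner (apply_op B' x) y = cinner x (apply_op A y)"
    then show "B' = B"
      using B by (intro bop_eqI cinner_eqI) (metis cinner_commute)
  qed (rule B)
  then show ?thesis
    using B by simp
qed

lemma cinner_adj_right: "cinner x (apply_op (adj A) y) = cinner (apply_op A x) y"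
  by (metis cinner_commute cinner_adj_left)

lemma bop_eq_cinnerI:
  "(\<And>x y. cinner x (apply_op A y) = cinner x (apply_op B y)) \<Longrightarrow> A = B"
  by (intro bop_eqI cinner_eqI)

lemma apply_op_scaleC_bop: "apply_op (c *\<^sub>C A) x = c *\<^sub>C apply_op A x"
  by (simp add: scaleC_bop.rep_eq)

lemmas cinner_simps = cinner_add_right cinner_add_left cinner_diff_right cinner_diff_left
  cinner_scaleC_right cinner_scaleC_left cinner_adj_right

lemma adj_adj [simp]: "adj (adj A) = A"
  by (rule bop_eq_cinnerI) (simp add: cinner_adj_right cinner_adj_left)

lemma adj_one [simp]: "adj 1 = 1"
  by (rule bop_eq_cinnerI) (simp add: cinner_adj_right apply_op_simps)

lemma adj_add: "adj (A + B) = adj A + adj B"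
  and adj_diff: "adj (A - B) = adj A - adj B"
  and adj_mult: "adj (A * B) = adj B * adj A"
  and adj_scaleC: "adj (c *\<^sub>C A) = cnj c *\<^sub>C adj A"
  by (rule bop_eq_cinnerI, simp add: cinner_simps apply_op_simps apply_op_scaleC_bop)+

lemma scaleC_mult_left: "(c *\<^sub>C A) * B = c *\<^sub>C (A * B :: 'h::chilbert_space bop)"
  and scaleC_mult_right: "A * (c *\<^sub>C B) = c *\<^sub>C (A * B :: 'h::chilbert_space bop)"
  by (rule bop_eqI, simp add: apply_op_simps apply_op_scaleC_bop apply_op_scaleC)+

section \<open>Operator order and positive operators\<close>

lemma less_eq_bop_iff: "A \<le> B \<longleftrightarrow> (\<forall>x. cinner x (apply_op B x) - cinner x (apply_op A x) \<in> \<real>\<^sub>\<ge>\<^sub>0)"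
  by (simp add: less_eq_bop_def apply_op_simps cinner_diff_right)

lemma bop_nonneg_iff: "0 \<le> A \<longleftrightarrow> (\<forall>x. cinner x (apply_op A x) \<in> \<real>\<^sub>\<ge>\<^sub>0)"
  by (simp add: less_eq_bop_iff apply_op_simps)

lemma bop_nonneg_diff_iff: "0 \<le> B - A \<longleftrightarrow> A \<le> (B :: 'h::chilbert_space bop)"
  by (simp add: less_eq_bop_def)

lemma adj_mult_nonneg: "0 \<le> adj A * A"
  by (simp add: bop_nonneg_iff apply_op_simps cinner_adj_right cinner_self)

lemma positive_form_bop:
  assumes "0 \<le> A"
  shows "positive_form UNIV (\<lambda>x y. cinner x (apply_op A y))"
  using assms
  by unfold_locales (auto simp: cinner_simps apply_op_add apply_op_scaleC bop_nonneg_iff)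

text \<open>The form of \<open>A - B\<close> vanishes on the diagonal, hence is positive with zero
  seminorm, and Cauchy-Schwarz makes it vanish everywhere.\<close>

lemma bop_eq_quadraticI:
  assumes "\<And>x. cinner x (apply_op A x) = cinner x (apply_op B x)"
  shows "A = B"
proof (rule bop_eq_cinnerI)
  fix x y
  interpret positive_form UNIV "\<lambda>x y. cinner x (apply_op (A - B) y)"
    by (rule positive_form_bop) (simp add: bop_nonneg_iff apply_op_simps cinner_diff_right assms)
  have "seminorm x = 0"
    unfolding seminorm_def using assms by (simp add: apply_op_simps cinner_diff_right)
  then show "cinner x (apply_op A y) = cinner x (apply_op B y)"
    using cauchy_schwarz[of x y] by (simp add: apply_op_simps cinner_diff_right)
qed

lemma nonneg_imp_self_adjoint:
  assumes "0 \<le> A"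
  shows "adj A = A"
proof (rule bop_eq_cinnerI)
  fix x y
  interpret positive_form UNIV "\<lambda>x y. cinner x (apply_op A y)"
    by (rule positive_form_bop[OF assms])
  show "cinner x (apply_op (adj A) y) = cinner x (apply_op A y)"
    using hermitian[of y x] by (metis UNIV_I cinner_adj_right cinner_commute)
qed

text \<open>This is \<open>A * A \<le> C A\<close> for \<open>0 \<le> A \<le> C\<close>, the
  substitute for square roots. It is Cauchy-Schwarz for the form of \<open>A\<close> at the pair
  \<open>(apply_op A x, x)\<close>.\<close>

lemma nonneg_norm_apply_le:
  assumes "0 \<le> A" and C: "\<And>x. Re (cinner x (apply_op A x)) \<le> C * (norm x)\<^sup>2"
  shows "(norm (apply_op A x))\<^sup>2 \<le> C * Re (cinner x (apply_op A x))"
proof -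
  interpret positive_form UNIV "\<lambda>x y. cinner x (apply_op A y)"
    by (rule positive_form_bop[OF assms(1)])
  let ?y = "apply_op A x"
  have "((norm ?y)\<^sup>2)\<^sup>2 = (cmod (cinner ?y (apply_op A x)))\<^sup>2"
    by (simp add: cinner_self norm_power)
  also have "\<dots> \<le> (seminorm ?y)\<^sup>2 * (seminorm x)\<^sup>2"
    using cauchy_schwarz[of ?y x] power_mono[of "cmod (cinner ?y (apply_op A x))" "seminorm ?y * seminorm x" 2]
    by (simp add: power_mult_distrib)
  also have "\<dots> \<le> (C * (norm ?y)\<^sup>2) * (seminorm x)\<^sup>2"
    using C[of ?y] by (intro mult_right_mono) (simp_all add: seminorm_def Re_nonneg)
  finally have *: "(norm ?y)\<^sup>2 * (norm ?y)\<^sup>2 \<le> (C * (seminorm x)\<^sup>2) * (norm ?y)\<^sup>2"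
    by (simp only: power2_eq_square mult_ac)
  show ?thesis
  proof (cases "?y = 0")
    case False
    then have "(norm ?y)\<^sup>2 \<le> C * (seminorm x)\<^sup>2"
      using mult_right_le_imp_le[OF *] by simp
    then show ?thesis
      by (simp add: seminorm_def Re_nonneg)
  qed simp
qed

section \<open>Ultraweak limits and compactness\<close>

definition op_bounded :: "real \<Rightarrow> 'h::chilbert_space bop \<Rightarrow> bool" where
  "op_bounded C A \<longleftrightarrow> (\<forall>x. norm (apply_op A x) \<le> C * norm x)"

lemma op_bounded_cinner:
  assumes "op_bounded C A"
  shows "cmod (cinner x (apply_op A y)) \<le> C * norm x * norm y"
proof -
  have "cmod (cinner x (apply_op A y)) \<le> norm x * norm (apply_op A y)"
    by (rule cmod_cinner_le)
  also have "\<dots> \<le> norm x * (C * norm y)"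
    using assms by (intro mult_left_mono) (auto simp: op_bounded_def)
  finally show ?thesis
    by (simp add: mult_ac)
qed

lemma ex_op_bounded:
  obtains C where "C > 0" "op_bounded C A"
proof -
  obtain C where C: "C \<ge> 0" "\<And>x. norm (apply_op A x) \<le> C * norm x"
    using bop_bounded by blast
  have "norm (apply_op A x) \<le> (C + 1) * norm x" for x
    using C(2)[of x] by (simp add: distrib_right add_increasing2)
  then show thesis
    using that[of "C + 1"] C(1) by (auto simp: op_bounded_def)
qed

lemma topspace_ultraweak [simp]: "topspace ultraweak = UNIV"
proof -
  have "square_summable (\<lambda>n. 0)"
    by (simp add: square_summable_def)
  then have "UNIV \<in> {vector_functional \<xi> \<eta> -` U | \<xi> \<eta> U.
      square_summable \<xi> \<and> square_summable \<eta> \<and> open U}"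
    using open_UNIV vimage_UNIV by blast
  then have "openin ultraweak UNIV"
    unfolding ultraweak_def by (rule topology_generated_by_Basis)
  then show ?thesis
    using openin_subset by blast
qed

text \<open>The generating sets decide convergence: the property that the values eventually enter
  every such neighbourhood of \<open>A\<close> passes to finite intersections and to unions.\<close>

lemma limitin_ultraweak_iff:
  fixes A :: "'h::chilbert_space bop"
  shows "limitin ultraweak x A F \<longleftrightarrow> (\<forall>\<xi> \<eta>. square_summable \<xi> \<longrightarrow> square_summable \<eta> \<longrightarrow>
     ((\<lambda>n. vector_functional \<xi> \<eta> (x n)) \<longlongrightarrow> vector_functional \<xi> \<eta> A) F)"
proof (intro iffI allI impI)
  fix \<xi> \<eta> :: "nat \<Rightarrow> 'h"
  assume lim: "limitin ultraweak x A F" and sq: "square_summable \<xi>" "square_summable \<eta>"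
  show "((\<lambda>n. vector_functional \<xi> \<eta> (x n)) \<longlongrightarrow> vector_functional \<xi> \<eta> A) F"
  proof (rule topological_tendstoI)
    fix S assume S: "open S" "vector_functional \<xi> \<eta> A \<in> S"
    have "openin ultraweak (vector_functional \<xi> \<eta> -` S)"
      unfolding ultraweak_def using S sq by (intro topology_generated_by_Basis) blast
    from limitinD[OF lim this]
    show "eventually (\<lambda>n. vector_functional \<xi> \<eta> (x n) \<in> S) F"
      using S by simp
  qed
next
  assume *: "\<forall>\<xi> \<eta>. square_summable \<xi> \<longrightarrow> square_summable \<eta> \<longrightarrow>
     ((\<lambda>n. vector_functional \<xi> \<eta> (x n)) \<longlongrightarrow> vector_functional \<xi> \<eta> A) F"
  have "A \<in> U \<longrightarrow> eventually (\<lambda>n. x n \<in> U) F" if "openin ultraweak U" for U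
    using that unfolding ultraweak_def openin_topology_generated_by_iff
  proof (induction rule: generate_topology_on.induct)
    case (Int a b)
    then show ?case
      by (auto elim: eventually_elim2)
  next
    case (UN K)
    show ?case
    proof
      assume "A \<in> \<Union>K"
      then obtain k where k: "k \<in> K" "A \<in> k"
        by blast
      with UN.IH have "eventually (\<lambda>n. x n \<in> k) F"
        by blast
      then show "eventually (\<lambda>n. x n \<in> \<Union>K) F"
        using k(1) by (auto elim: eventually_mono)
    qed
  next
    case (Basis s)
    show ?case
    proof
      assume "A \<in> s"
      moreover from Basis obtain \<xi> \<eta> U where s: "s = vector_functional \<xi> \<eta> -` U"
        and sq: "square_summable \<xi>" "square_summable \<eta>" and "open U"
        by blast
      ultimately show "eventually (\<lambda>n. x n \<in> s) F"
        using topological_tendstoD[OF *[rule_format, OF sq] \<open>open U\<close>] by simp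
    qed
  qed simp
  then show "limitin ultraweak x A F"
    by (simp add: limitin_def)
qed

lemma limitin_ultraweak_cinner:
  fixes A :: "'h::chilbert_space bop"
  assumes "limitin ultraweak x A F"
  shows "((\<lambda>n. cinner v (apply_op (x n) w)) \<longlongrightarrow> cinner v (apply_op A w)) F"
proof -
  \<comment> \<open>Sequences supported at one index reduce an ultraweak functional to a single
    matrix coefficient.\<close>
  define \<delta> :: "'h \<Rightarrow> nat \<Rightarrow> 'h" where "\<delta> = (\<lambda>v n. if n = 0 then v else 0)"
  have "summable (\<lambda>n. (norm (\<delta> v n))\<^sup>2)" for v
    by (rule summable_finite[of "{0}"]) (auto simp: \<delta>_def)
  then have sq: "square_summable (\<delta> v)" for v
    by (simp add: square_summable_def)
  have "vector_functional (\<delta> v) (\<delta> w) B = cinner v (apply_op B w)" for B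
    using suminf_finite[of "{0}" "\<lambda>n. cinner (\<delta> v n) (apply_op B (\<delta> w n))"]
    by (simp add: vector_functional_def \<delta>_def)
  then show ?thesis
    using assms[unfolded limitin_ultraweak_iff, rule_format, OF sq[of v] sq[of w]] by simp
qed

text \<open>On bounded sets weak convergence is ultraweak convergence: the bound dominates the
  series of a functional by a summable \<open>m\<close>, uniformly in the index, so Tannery's
  theorem allows termwise limits.\<close>

lemma limitin_ultraweakI:
  fixes A :: "'h::chilbert_space bop"
  assumes bounded: "\<And>n. op_bounded C (x n)"
    and F: "F \<noteq> bot"
    and lim: "\<And>v w. ((\<lambda>n. cinner v (apply_op (x n) w)) \<longlongrightarrow> cinner v (apply_op A w)) F"
  shows "limitin ultraweak x A F"
  unfolding limitin_ultraweak_iff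
proof (intro allI impI)
  fix \<xi> \<eta> :: "nat \<Rightarrow> 'h"
  assume sq: "square_summable \<xi>" "square_summable \<eta>"
  define m where "m k = \<bar>C\<bar> * ((norm (\<xi> k))\<^sup>2 + (norm (\<eta> k))\<^sup>2)" for k
  have "summable m"
    unfolding m_def using sq by (intro summable_mult summable_add) (auto simp: square_summable_def)
  have "cmod (cinner (\<xi> k) (apply_op (x n) (\<eta> k))) \<le> m k" for k n
  proof -
    have "cmod (cinner (\<xi> k) (apply_op (x n) (\<eta> k))) \<le> C * (norm (\<xi> k) * norm (\<eta> k))"
      using op_bounded_cinner[OF bounded] by (simp add: mult.assoc)
    also have "\<dots> \<le> \<bar>C\<bar> * (norm (\<xi> k) * norm (\<eta> k))"
      by (intro mult_right_mono) auto
    also have "norm (\<xi> k) * norm (\<eta> k) \<le> (norm (\<xi> k))\<^sup>2 + (norm (\<eta> k))\<^sup>2"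
    proof -
      have "0 \<le> norm (\<xi> k) * norm (\<eta> k)"
        by simp
      then show ?thesis
        using sum_squares_bound[of "norm (\<xi> k)" "norm (\<eta> k)"] by linarith
    qed
    finally show ?thesis
      by (simp add: m_def mult_left_mono)
  qed
  then have "eventually (\<lambda>(k, n). cmod (cinner (\<xi> k) (apply_op (x n) (\<eta> k))) \<le> m k)
      (at_top \<times>\<^sub>F F)"
    by (intro always_eventually) auto
  from tannerys_theorem[OF lim this \<open>summable m\<close> F]
  show "((\<lambda>n. vector_functional \<xi> \<eta> (x n)) \<longlongrightarrow> vector_functional \<xi> \<eta> A) F"
    by (simp add: vector_functional_def)
qed

text \<open>Lifts a cluster point of the image filter to a proper filter on the indices along which
  the family itself converges.\<close>

lemma inf_filtercomap_neq_bot: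
  assumes "inf N (filtermap G F) \<noteq> bot"
  shows "inf (filtercomap G N) F \<noteq> bot"
proof
  assume "inf (filtercomap G N) F = bot"
  then obtain P Q where "eventually P (filtercomap G N)" "eventually Q F" and
    PQ: "\<And>n. P n \<Longrightarrow> Q n \<Longrightarrow> False"
    unfolding trivial_limit_def eventually_inf by blast
  then obtain P' where P': "eventually P' N" "\<And>n. P' (G n) \<Longrightarrow> P n"
    unfolding eventually_filtercomap by blast
  have "eventually (\<lambda>y. \<exists>n. y = G n \<and> Q n) (filtermap G F)"
    using \<open>eventually Q F\<close> unfolding eventually_filtermap by (rule eventually_mono) blast
  then have "eventually (\<lambda>_. False) (inf N (filtermap G F))"
    unfolding eventually_inf using P' PQ by blast
  then show False
    using assms trivial_limit_def by blast
qed

text \<open>Banach-Alaoglu by hand: the matrix coefficients live in a product of closed discs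
  indexed by pairs of vectors, compact by Tychonoff, and a limit of coefficients is again a bounded
  sesquilinear form. Such a product need not be sequentially compact, hence the filter
  \<open>U\<close>.\<close>

lemma bounded_sequence_cluster_point:
  fixes x :: "'i \<Rightarrow> 'h::chilbert_space bop"
  assumes bounded: "\<And>n. op_bounded C (x n)" and F: "F \<noteq> bot"
  obtains U A where "U \<le> F" "U \<noteq> bot" "limitin ultraweak x A U"
proof -
  define G where "G = (\<lambda>n (p :: 'h \<times> 'h). cinner (fst p) (apply_op (x n) (snd p)))"
  define K where "K = (PiE UNIV (\<lambda>p :: 'h \<times> 'h. cball (0 :: complex) (C * norm (fst p) * norm (snd p))))"
  have "compactin (product_topology (\<lambda>_. euclidean) UNIV) K"
    unfolding K_def compactin_PiE by (simp add: compactin_euclidean_iff)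
  then have "compact K"
    by (simp add: euclidean_product_topology)
  moreover have "eventually (\<lambda>g. g \<in> K) (filtermap G F)"
    using op_bounded_cinner[OF bounded] by (simp add: eventually_filtermap K_def G_def PiE_iff)
  moreover have "filtermap G F \<noteq> bot"
    using F by (simp add: filtermap_bot_iff)
  ultimately obtain g where g: "g \<in> K" "inf (nhds g) (filtermap G F) \<noteq> bot"
    unfolding compact_filter by blast
  define U where "U = inf (filtercomap G (nhds g)) F"
  have U: "U \<le> F" "U \<noteq> bot"
    using inf_filtercomap_neq_bot[OF g(2)] by (simp_all add: U_def)
  have "(G \<longlongrightarrow> g) U"
    unfolding U_def by (rule filterlim_mono[OF filterlim_filtercomap order_refl]) simp
  then have "((\<lambda>n. G n p) \<longlongrightarrow> g p) U" for p
    using continuous_on_tendsto_compose[OF continuous_on_product_coordinates[of p], of G g U] by simp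
  then have lim: "((\<lambda>n. cinner v (apply_op (x n) w)) \<longlongrightarrow> g (v, w)) U" for v w
    using \<open>\<And>p. ((\<lambda>n. G n p) \<longlongrightarrow> g p) U\<close>[of "(v, w)"] by (simp add: G_def)
  have "\<exists>A. \<forall>v w. cinner v (apply_op A w) = g (v, w)"
  proof (rule bop_of_form[of "\<lambda>v w. g (v, w)" C])
    fix v w u c
    show "g (v, w + u) = g (v, w) + g (v, u)"
      using tendsto_add[OF lim[of v w] lim[of v u]] lim[of v "w + u"]
      by (intro tendsto_unique[OF U(2)]) (simp_all add: apply_op_add cinner_add_right)
    show "g (v + w, u) = g (v, u) + g (w, u)"
      using tendsto_add[OF lim[of v u] lim[of w u]] lim[of "v + w" u]
      by (intro tendsto_unique[OF U(2)]) (simp_all add: cinner_add_left)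
    show "g (v, c *\<^sub>C w) = c * g (v, w)"
      using tendsto_mult[OF tendsto_const[of c] lim[of v w]] lim[of v "c *\<^sub>C w"]
      by (intro tendsto_unique[OF U(2)]) (simp_all add: apply_op_scaleC cinner_scaleC_right)
    show "g (c *\<^sub>C v, w) = cnj c * g (v, w)"
      using tendsto_mult[OF tendsto_const[of "cnj c"] lim[of v w]] lim[of "c *\<^sub>C v" w]
      by (intro tendsto_unique[OF U(2)]) (simp_all add: cinner_scaleC_left)
    show "cmod (g (v, w)) \<le> C * norm v * norm w"
      using g(1) by (simp add: K_def PiE_iff)
  qed (intro exI allI, assumption)
  then obtain A where A: "\<And>v w. cinner v (apply_op A w) = g (v, w)"
    by blast
  show thesis
  proof (rule that[OF U])
    show "limitin ultraweak x A U"
      by (rule limitin_ultraweakI[where C = C]) (use bounded U A lim in auto)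
  qed
qed

section \<open>Von Neumann algebras\<close>

locale von_neumann =
  fixes M :: "'h::chilbert_space bop set"
  assumes von_neumann_algebra: "von_neumann_algebra M"
begin

lemma adj_closed: "a \<in> M \<Longrightarrow> adj a \<in> M"
  and double_commutant: "commutant (commutant M) = M"
  using von_neumann_algebra unfolding von_neumann_algebra_def by blast+

lemma mem_iff: "a \<in> M \<longleftrightarrow> (\<forall>b\<in>commutant M. a * b = b * a)"
  by (subst double_commutant[symmetric], subst commutant_def) (rule mem_Collect_eq)

lemma commute: "\<lbrakk>a \<in> M; c \<in> commutant M\<rbrakk> \<Longrightarrow> a * c = c * a"
  and memI: "(\<And>c. c \<in> commutant M \<Longrightarrow> a * c = c * a) \<Longrightarrow> a \<in> M"
  by (rule mem_iff[THEN iffD1, rule_format], assumption+) (rule mem_iff[THEN iffD2], rule ballI)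

lemma one_closed: "1 \<in> M"
  by (rule memI) simp

lemma zero_closed: "0 \<in> M"
  by (rule memI) simp

lemma add_closed: "\<lbrakk>a \<in> M; b \<in> M\<rbrakk> \<Longrightarrow> a + b \<in> M"
  by (rule memI) (simp only: distrib_left distrib_right commute)

lemma diff_closed: "\<lbrakk>a \<in> M; b \<in> M\<rbrakk> \<Longrightarrow> a - b \<in> M"
  by (rule memI) (simp only: left_diff_distrib right_diff_distrib commute)

lemma scaleC_closed: "a \<in> M \<Longrightarrow> c *\<^sub>C a \<in> M"
  by (rule memI) (simp only: scaleC_mult_left scaleC_mult_right commute)

lemma mult_closed: "\<lbrakk>a \<in> M; b \<in> M\<rbrakk> \<Longrightarrow> a * b \<in> M"
  by (rule memI) (metis (no_types) commute mult.assoc)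

lemmas closed = adj_closed one_closed add_closed mult_closed scaleC_closed diff_closed zero_closed

lemma power_closed: "a \<in> M \<Longrightarrow> a ^ n \<in> M"
  by (induction n) (auto intro: closed)

text \<open>\<open>M\<close> is a commutant, and commuting with a fixed \<open>b\<close> survives
  weak limits: in a matrix coefficient \<open>b\<close> can be moved onto the vectors.\<close>

lemma limit_closed:
  assumes "\<And>n. x n \<in> M" "limitin ultraweak x A U" "U \<noteq> bot"
  shows "A \<in> M"
proof (intro memI bop_eq_cinnerI)
  fix b v w assume b: "b \<in> commutant M"
  have lim: "((\<lambda>n. cinner v (apply_op (x n) (apply_op b w))) \<longlongrightarrow> cinner v (apply_op A (apply_op b w))) U"
    by (rule limitin_ultraweak_cinner[OF assms(2)])
  have eq: "cinner v (apply_op (x n) (apply_op b w)) =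
      cinner (apply_op (adj b) v) (apply_op (x n) w)" for n
  proof -
    have "x n * b = b * x n"
      by (rule commute[OF assms(1) b])
    then have "apply_op (x n) (apply_op b w) = apply_op b (apply_op (x n) w)"
      by (metis times_bop.rep_eq)
    then show ?thesis
      by (simp add: cinner_adj_left)
  qed
  have "cinner v (apply_op A (apply_op b w)) = cinner (apply_op (adj b) v) (apply_op A w)"
    by (rule tendsto_unique[OF assms(3) lim[unfolded eq] limitin_ultraweak_cinner[OF assms(2)]])
  then show "cinner v (apply_op (A * b) w) = cinner v (apply_op (b * A) w)"
    by (simp add: apply_op_simps cinner_adj_left)
qed

text \<open>Ultraweak limits inside the algebra are phrased in the subspace topology, in which Schwartz
  maps and normal states are continuous.\<close>

abbreviation uw_limit :: "('i \<Rightarrow> 'h bop) \<Rightarrow> 'h bop \<Rightarrow> 'i filter \<Rightarrow> bool" where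
  "uw_limit \<equiv> limitin (subtopology ultraweak M)"

lemma uw_limitI:
  assumes "\<And>n. x n \<in> M" "limitin ultraweak x A U" "U \<noteq> bot"
  shows "uw_limit x A U"
proof -
  have "eventually (\<lambda>n. x n \<in> V \<inter> M) U" if "openin ultraweak V" "A \<in> V" for V
    using limitinD[OF assms(2) that] assms(1) by simp
  then show ?thesis
    using limit_closed[OF assms] by (auto simp: limitin_def openin_subtopology)
qed

lemma uw_limit_mem: "uw_limit x A U \<Longrightarrow> A \<in> M"
  using limitin_topspace[of "subtopology ultraweak M" x A U] by simp

lemma uw_limit_ultraweak: "uw_limit x A U \<Longrightarrow> limitin ultraweak x A U"
proof -
  assume lim: "uw_limit x A U"
  have "eventually (\<lambda>n. x n \<in> V) U" if "openin ultraweak V" "A \<in> V" for V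
  proof -
    have "eventually (\<lambda>n. x n \<in> V \<inter> M) U"
      using limitinD[OF lim openin_subtopology_Int[OF that(1)]] that(2) uw_limit_mem[OF lim]
      by simp
    then show ?thesis
      by (rule eventually_mono) simp
  qed
  then show ?thesis
    by (simp add: limitin_def)
qed

text \<open>In an ultraweak functional, \<open>a\<close> moves to \<open>adj a\<close> on the first
  sequence, which stays square summable because \<open>adj a\<close> is bounded.\<close>

lemma uw_limit_mult_left:
  assumes "a \<in> M" "\<And>n. x n \<in> M" "uw_limit x A U" "U \<noteq> bot"
  shows "uw_limit (\<lambda>n. a * x n) (a * A) U"
proof (rule uw_limitI)
  show "limitin ultraweak (\<lambda>n. a * x n) (a * A) U"
    unfolding limitin_ultraweak_iff
  proof (intro allI impI)
    fix \<xi> \<eta> :: "nat \<Rightarrow> 'h"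
    assume sq: "square_summable \<xi>" "square_summable \<eta>"
    obtain C where C: "C > 0" "op_bounded C (adj a)"
      using ex_op_bounded by blast
    have "norm ((norm (apply_op (adj a) (\<xi> n)))\<^sup>2) \<le> C\<^sup>2 * (norm (\<xi> n))\<^sup>2" for n
      using C power_mono[of "norm (apply_op (adj a) (\<xi> n))" "C * norm (\<xi> n)" 2]
      by (simp add: op_bounded_def power_mult_distrib)
    then have "square_summable (\<lambda>n. apply_op (adj a) (\<xi> n))"
      unfolding square_summable_def
      by (rule summable_comparison_test'[OF summable_mult[OF sq(1)[unfolded square_summable_def]]])
    from uw_limit_ultraweak[OF assms(3), unfolded limitin_ultraweak_iff, rule_format, OF this sq(2)]
    show "((\<lambda>n. vector_functional \<xi> \<eta> (a * x n)) \<longlongrightarrow> vector_functional \<xi> \<eta> (a * A)) U"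
      by (simp add: vector_functional_def cinner_adj_left apply_op_simps)
  qed
  show "a * x n \<in> M" for n
    by (rule mult_closed[OF assms(1,2)])
qed (rule assms(4))

lemma bounded_sequence_cluster:
  assumes "\<And>n. x n \<in> M" "\<And>n. op_bounded C (x n)" "F \<noteq> bot"
  obtains U A where "U \<le> F" "U \<noteq> bot" "uw_limit x A U"
proof -
  obtain U A where "U \<le> F" "U \<noteq> bot" "limitin ultraweak x A U"
    by (rule bounded_sequence_cluster_point[of C x F, OF assms(2,3)])
  then show thesis
    by (intro that uw_limitI[OF assms(1)])
qed

end

section \<open>Schwartz maps\<close>

lemma bop_le_trans: "\<lbrakk>A \<le> B; B \<le> C\<rbrakk> \<Longrightarrow> A \<le> (C :: 'h::chilbert_space bop)"
  unfolding less_eq_bop_iff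
proof
  fix x
  assume "\<forall>x. cinner x (apply_op B x) - cinner x (apply_op A x) \<in> \<real>\<^sub>\<ge>\<^sub>0"
    "\<forall>x. cinner x (apply_op C x) - cinner x (apply_op B x) \<in> \<real>\<^sub>\<ge>\<^sub>0"
  then have "(cinner x (apply_op B x) - cinner x (apply_op A x)) +
      (cinner x (apply_op C x) - cinner x (apply_op B x)) \<in> \<real>\<^sub>\<ge>\<^sub>0"
    by (intro nonneg_Reals_add_I) auto
  then show "cinner x (apply_op C x) - cinner x (apply_op A x) \<in> \<real>\<^sub>\<ge>\<^sub>0"
    by simp
qed

lemma bop_le_Re: "A \<le> B \<Longrightarrow> Re (cinner x (apply_op A x)) \<le> Re (cinner x (apply_op B x))"
  by (simp add: less_eq_bop_iff complex_nonneg_Reals_iff)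

lemma self_adjoint_Im_zero: "adj A = A \<Longrightarrow> Im (cinner x (apply_op A x)) = 0"
proof -
  assume "adj A = A"
  then have "cinner x (apply_op A x) = cnj (cinner x (apply_op A x))"
    using cinner_adj_left[of A x x] cinner_commute[of "apply_op A x" x] by simp
  from arg_cong[OF this, of Im] show ?thesis
    by simp
qed

lemma Re_cinner_adj_mult: "Re (cinner x (apply_op (adj A * A) x)) = (norm (apply_op A x))\<^sup>2"
  by (simp add: apply_op_simps cinner_adj_right cinner_self)

lemma Re_cinner_le: "op_bounded C A \<Longrightarrow> Re (cinner x (apply_op A x)) \<le> C * (norm x)\<^sup>2"
  using op_bounded_cinner[of C A x x] complex_Re_le_cmod[of "cinner x (apply_op A x)"]
  by (simp add: power2_eq_square mult.assoc)

section \<open>Arithmetic of operator bounds\<close>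

lemma op_boundedI_unit:
  assumes "\<And>x. norm x = 1 \<Longrightarrow> norm (apply_op A x) \<le> C"
  shows "op_bounded C A"
  unfolding op_bounded_def
proof
  fix x
  show "norm (apply_op A x) \<le> C * norm x"
  proof (cases "x = 0")
    case False
    define y where "y = complex_of_real (1 / norm x) *\<^sub>C x"
    have "norm y = 1"
      using False by (simp add: y_def norm_scaleC norm_divide)
    moreover have "norm (apply_op A y) = norm (apply_op A x) / norm x"
      by (simp add: y_def apply_op_scaleC norm_scaleC norm_divide)
    ultimately have "norm (apply_op A x) / norm x \<le> C"
      using assms[of y] by simp
    then show ?thesis
      using False by (simp add: divide_le_eq)
  qed simp
qed

lemma op_bounded_mult: "\<lbrakk>op_bounded C A; op_bounded D B; 0 \<le> C\<rbrakk> \<Longrightarrow> op_bounded (C * D) (A * B)"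
  unfolding op_bounded_def apply_op_simps
  by (metis mult.assoc mult_left_mono order_trans)

lemma op_bounded_one: "op_bounded 1 1"
  by (simp add: op_bounded_def apply_op_simps)

lemma op_bounded_power: "\<lbrakk>op_bounded C A; 0 \<le> C\<rbrakk> \<Longrightarrow> op_bounded (C ^ n) (A ^ n)"
  by (induction n) (auto intro: op_bounded_mult op_bounded_one)

lemma op_bounded_mono: "\<lbrakk>op_bounded C A; C \<le> D\<rbrakk> \<Longrightarrow> op_bounded D A"
  unfolding op_bounded_def by (meson mult_right_mono norm_ge_zero order_trans)

lemma op_bounded_scaleC: "op_bounded C A \<Longrightarrow> op_bounded (cmod c * C) (c *\<^sub>C A)"
  by (simp add: op_bounded_def apply_op_scaleC_bop norm_scaleC mult.assoc mult_left_mono)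

lemma op_bounded_add: "\<lbrakk>op_bounded C A; op_bounded D B\<rbrakk> \<Longrightarrow> op_bounded (C + D) (A + B)"
  unfolding op_bounded_def apply_op_simps distrib_right
  by (intro allI) (rule order_trans[OF norm_triangle_ineq add_mono], blast+)

lemma op_bounded_adj:
  assumes "op_bounded C A"
  shows "op_bounded C (adj A)"
  unfolding op_bounded_def
proof
  fix x
  let ?y = "apply_op (adj A) x"
  have "(norm ?y)\<^sup>2 = cmod (cinner (apply_op A ?y) x)"
    using arg_cong[OF cinner_adj_right[of ?y A x], of cmod] by (simp add: cinner_self norm_power)
  also have "\<dots> \<le> norm (apply_op A ?y) * norm x"
    by (rule cmod_cinner_le)
  also have "\<dots> \<le> C * norm ?y * norm x"
    using assms by (intro mult_right_mono) (auto simp: op_bounded_def)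
  finally have *: "norm ?y * norm ?y \<le> (C * norm x) * norm ?y"
    by (simp add: power2_eq_square mult_ac)
  show "norm ?y \<le> C * norm x"
  proof (cases "?y = 0")
    case True
    have "0 \<le> C * norm x"
      using assms by (meson norm_ge_zero op_bounded_def order_trans)
    then show ?thesis
      using True by simp
  next
    case False
    then show ?thesis
      using mult_right_le_imp_le[OF *] by simp
  qed
qed

lemma self_adjoint_power: "adj A = A \<Longrightarrow> adj (A ^ n) = A ^ n"
  by (induction n) (auto simp: adj_mult power_commutes)

section \<open>Involution, contractivity, positivity and multiplicative domain of a Schwartz
  map\<close>

locale schwartz_map = von_neumann M for M :: "'h::chilbert_space bop set" +
  fixes \<Psi> :: "'h bop \<Rightarrow> 'h bop"
  assumes unital_schwartz_map: "unital_schwartz_map M \<Psi>"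
begin

lemma maps: "a \<in> M \<Longrightarrow> \<Psi> a \<in> M"
  and map_add: "\<lbrakk>a \<in> M; b \<in> M\<rbrakk> \<Longrightarrow> \<Psi> (a + b) = \<Psi> a + \<Psi> b"
  and map_scaleC: "a \<in> M \<Longrightarrow> \<Psi> (c *\<^sub>C a) = c *\<^sub>C \<Psi> a"
  and map_one: "\<Psi> 1 = 1"
  and map_schwarz: "a \<in> M \<Longrightarrow> \<Psi> (adj a) * \<Psi> a \<le> \<Psi> (adj a * a)"
  and map_schwarz_nonneg: "a \<in> M \<Longrightarrow> 0 \<le> \<Psi> (adj a) * \<Psi> a"
  using unital_schwartz_map by (simp_all add: unital_schwartz_map_def clinear_on_def Pi_iff)

lemma map_diff: "\<lbrakk>a \<in> M; b \<in> M\<rbrakk> \<Longrightarrow> \<Psi> (a - b) = \<Psi> a - \<Psi> b"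
  using map_add[of a "(-1) *\<^sub>C b"] map_scaleC[of b "-1"] scaleC_closed[of b "-1"]
  by (simp add: scaleC_minus_one)

lemma map_uw_limit: "uw_limit x A U \<Longrightarrow> uw_limit (\<lambda>n. \<Psi> (x n)) (\<Psi> A) U"
  using continuous_map_limit[of "subtopology ultraweak M" "subtopology ultraweak M" \<Psi> x A U]
    unital_schwartz_map by (simp add: unital_schwartz_map_def comp_def)

text \<open>Both halves of the Schwartz condition chain to
  \<open>0 \<le> \<Psi> (adj x * x)\<close>, so \<open>\<Psi> (adj x * y)\<close> evaluated at a
  vector is a positive form. Its symmetry at the pair \<open>(1, a)\<close> is the claim.\<close>

lemma map_adj:
  assumes a: "a \<in> M"
  shows "\<Psi> (adj a) = adj (\<Psi> a)"
proof (rule bop_eq_quadraticI)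
  fix \<xi>
  interpret B: positive_form M "\<lambda>x y. cinner \<xi> (apply_op (\<Psi> (adj x * y)) \<xi>)"
  proof
    fix x y z c
    assume x: "x \<in> M"
    show "cinner \<xi> (apply_op (\<Psi> (adj x * x)) \<xi>) \<in> \<real>\<^sub>\<ge>\<^sub>0"
      using bop_le_trans[OF map_schwarz_nonneg map_schwarz, OF x x] by (simp add: bop_nonneg_iff)
    assume y: "y \<in> M"
    show "cinner \<xi> (apply_op (\<Psi> (adj x * (c *\<^sub>C y))) \<xi>) = c * cinner \<xi> (apply_op (\<Psi> (adj x * y)) \<xi>)"
      using x y by (simp add: scaleC_mult_right map_scaleC closed apply_op_scaleC_bop cinner_simps)
    show "cinner \<xi> (apply_op (\<Psi> (adj (c *\<^sub>C x) * y)) \<xi>) = cnj c * cinner \<xi> (apply_op (\<Psi> (adj x * y)) \<xi>)"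
      using x y by (simp add: scaleC_mult_left adj_scaleC map_scaleC closed apply_op_scaleC_bop cinner_simps)
    assume z: "z \<in> M"
    show "cinner \<xi> (apply_op (\<Psi> (adj x * (y + z))) \<xi>) =
        cinner \<xi> (apply_op (\<Psi> (adj x * y)) \<xi>) + cinner \<xi> (apply_op (\<Psi> (adj x * z)) \<xi>)"
      using x y z by (simp add: distrib_left map_add closed apply_op_simps cinner_simps)
    show "cinner \<xi> (apply_op (\<Psi> (adj (x + y) * z)) \<xi>) =
        cinner \<xi> (apply_op (\<Psi> (adj x * z)) \<xi>) + cinner \<xi> (apply_op (\<Psi> (adj y * z)) \<xi>)"
      using x y z by (simp add: distrib_right adj_add map_add closed apply_op_simps cinner_simps)
  qed (auto intro: closed)
  have "cinner \<xi> (apply_op (\<Psi> (adj a)) \<xi>) = cnj (cinner \<xi> (apply_op (\<Psi> a) \<xi>))"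
    using B.hermitian[OF one_closed a] by simp
  then show "cinner \<xi> (apply_op (\<Psi> (adj a)) \<xi>) = cinner \<xi> (apply_op (adj (\<Psi> a)) \<xi>)"
    by (simp add: cinner_adj_right flip: cinner_commute)
qed

lemma map_schwarz': "a \<in> M \<Longrightarrow> adj (\<Psi> a) * \<Psi> a \<le> \<Psi> (adj a * a)"
  using map_schwarz[of a] map_adj[of a] by simp

text \<open>Without square roots, contractivity is obtained by iterating the Schwarz inequality: if
  \<open>\<langle>\<xi>, \<Psi>(x) \<xi>\<rangle> \<ge> 1\<close>, then \<open>\<langle>\<xi>, \<Psi>(x\<^bsup>2^n\<^esup>) \<xi>\<rangle> \<ge> 1\<close> for all \<open>n\<close>, although \<open>x\<^bsup>2^n\<^esup>\<close> tends to \<open>0\<close>.\<close>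

lemma quadratic_form_less_one:
  assumes x: "x \<in> M" "adj x = x" "op_bounded r x" and r: "0 \<le> r" "r < 1" and \<xi>: "norm \<xi> = 1"
  shows "Re (cinner \<xi> (apply_op (\<Psi> x) \<xi>)) < 1"
proof (rule ccontr)
  assume not_less: "\<not> Re (cinner \<xi> (apply_op (\<Psi> x) \<xi>)) < 1"
  define s where "s n = Re (cinner \<xi> (apply_op (\<Psi> (x ^ 2 ^ n)) \<xi>))" for n :: nat
  have s: "s n \<ge> 1" for n
  proof (induction n)
    case 0
    then show ?case
      using not_less by (simp add: s_def)
  next
    case (Suc n)
    \<comment> \<open>\<open>(s n)\<^sup>2 \<le> s (Suc n)\<close>: Cauchy-Schwarz against the unit
      vector \<open>\<xi>\<close>, then the Schwarz inequality for the self-adjoint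
      \<open>?y\<close>.\<close>
    let ?y = "x ^ 2 ^ n"
    have "1 \<le> (s n)\<^sup>2"
      using Suc.IH by simp
    also have "\<dots> \<le> (norm (apply_op (\<Psi> ?y) \<xi>))\<^sup>2"
      using Suc.IH complex_Re_le_cmod[of "cinner \<xi> (apply_op (\<Psi> ?y) \<xi>)"]
        cmod_cinner_le[of \<xi> "apply_op (\<Psi> ?y) \<xi>"] \<xi>
      by (intro power_mono) (auto simp: s_def)
    also have "\<dots> \<le> Re (cinner \<xi> (apply_op (\<Psi> (adj ?y * ?y)) \<xi>))"
      using bop_le_Re[OF map_schwarz'[OF power_closed[OF x(1)]]] by (simp only: Re_cinner_adj_mult)
    also have "adj ?y * ?y = x ^ 2 ^ Suc n"
      by (simp add: self_adjoint_power x(2) mult_2 power_add)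
    finally show ?case
      by (simp add: s_def)
  qed
  have r2: "(\<lambda>n. r ^ 2 ^ n) \<longlonglongrightarrow> 0"
    using filterlim_compose[OF LIMSEQ_power_zero[of r]] r
      filterlim_subseq[of "\<lambda>n::nat. (2::nat) ^ n"] by (simp add: strict_mono_def)
  have pb: "op_bounded (r ^ 2 ^ n) (x ^ 2 ^ n)" for n
    by (rule op_bounded_power[OF x(3) r(1)])
  have "uw_limit (\<lambda>n. x ^ 2 ^ n) 0 sequentially"
  proof (rule uw_limitI)
    show "limitin ultraweak (\<lambda>n. x ^ 2 ^ n) 0 sequentially"
    proof (rule limitin_ultraweakI)
      show "op_bounded 1 (x ^ 2 ^ n)" for n
        by (rule op_bounded_mono[OF pb]) (use r in \<open>simp add: power_le_one\<close>)
      fix v w :: 'h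
      have "(\<lambda>n. r ^ 2 ^ n * (norm v * norm w)) \<longlonglongrightarrow> 0"
        by (rule tendsto_mult_left_zero[OF r2])
      then have "(\<lambda>n. cinner v (apply_op (x ^ 2 ^ n) w)) \<longlonglongrightarrow> 0"
        by (rule Lim_null_comparison[rotated])
          (simp add: always_eventually op_bounded_cinner[OF pb] flip: mult.assoc)
      then show "(\<lambda>n. cinner v (apply_op (x ^ 2 ^ n) w)) \<longlonglongrightarrow> cinner v (apply_op 0 w)"
        by (simp add: apply_op_simps)
    qed simp
    show "x ^ 2 ^ n \<in> M" for n
      by (rule power_closed[OF x(1)])
  qed simp
  \<comment> \<open>Only ultraweak continuity of \<open>\<Psi>\<close> may be used here; its norm
    continuity is what this argument leads to.\<close>
  then have "(\<lambda>n. cinner \<xi> (apply_op (\<Psi> (x ^ 2 ^ n)) \<xi>)) \<longlonglongrightarrow> cinner \<xi> (apply_op (\<Psi> 0) \<xi>)"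
    by (intro limitin_ultraweak_cinner uw_limit_ultraweak map_uw_limit)
  then have "s \<longlonglongrightarrow> Re (cinner \<xi> (apply_op (\<Psi> 0) \<xi>))"
    unfolding s_def by (rule tendsto_Re)
  moreover have "\<Psi> 0 = 0"
    using map_diff[of 1 1] one_closed by simp
  ultimately have "s \<longlonglongrightarrow> 0"
    by (simp add: apply_op_simps)
  from LIMSEQ_le_const[OF this, of 1] show False
    using s by simp
qed

text \<open>The preceding bound is applied to \<open>adj b * b\<close> for \<open>b = a / K\<close>,
  and the Schwarz inequality turns it into a bound on \<open>\<Psi> b\<close>. It requires an
  operator bound strictly below 1, so \<open>K > C\<close> is taken first and then brought down to
  \<open>C\<close>.\<close>

lemma map_op_bounded:
  assumes a: "a \<in> M" "op_bounded C a" and C: "0 \<le> C"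
  shows "op_bounded C (\<Psi> a)"
  unfolding op_bounded_def
proof
  fix x
  have bound: "norm (apply_op (\<Psi> a) x) \<le> K * norm x" if K: "C < K" for K
  proof -
    define r where "r = C / K"
    have r: "0 \<le> r" "r < 1"
      using C K by (simp_all add: r_def)
    define b where "b = complex_of_real (1 / K) *\<^sub>C a"
    have bM: "b \<in> M"
      using a by (simp add: b_def scaleC_closed)
    have "op_bounded r b"
      using op_bounded_scaleC[OF a(2), of "complex_of_real (1 / K)"] K C
      by (simp add: b_def r_def norm_divide)
    then have bb: "op_bounded (r * r) (adj b * b)"
      using r(1) by (intro op_bounded_mult op_bounded_adj)
    have "op_bounded 1 (\<Psi> b)"
    proof (rule op_boundedI_unit)
      fix y :: 'h assume y: "norm y = 1"
      have "(norm (apply_op (\<Psi> b) y))\<^sup>2 \<le> Re (cinner y (apply_op (\<Psi> (adj b * b)) y))"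
        using bop_le_Re[OF map_schwarz'[OF bM]] by (simp only: Re_cinner_adj_mult)
      also have "\<dots> < 1"
      proof (rule quadratic_form_less_one[OF _ _ bb])
        show "r * r < 1"
          using r mult_strict_mono[of r 1 r 1] by simp
      qed (use bM r y in \<open>simp_all add: adj_mult closed\<close>)
      finally show "norm (apply_op (\<Psi> b) y) \<le> 1"
        using power2_le_imp_le[of "norm (apply_op (\<Psi> b) y)" 1] by simp
    qed
    moreover have "\<Psi> b = complex_of_real (1 / K) *\<^sub>C \<Psi> a"
      using a by (simp add: b_def map_scaleC)
    ultimately have "norm (apply_op (\<Psi> a) x) / K \<le> norm x"
      using K C by (simp add: op_bounded_def apply_op_scaleC_bop norm_scaleC norm_divide)
    then show ?thesis
      using K C by (simp add: field_simps)
  qed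
  show "norm (apply_op (\<Psi> a) x) \<le> C * norm x"
  proof (rule field_le_epsilon)
    fix e :: real assume e: "0 < e"
    \<comment> \<open>The excess of \<open>K\<close> over \<open>C\<close> is scaled so that it
      costs at most \<open>e\<close> at this \<open>x\<close>; the added 1 covers
      \<open>x = 0\<close>.\<close>
    have "norm (apply_op (\<Psi> a) x) \<le> (C + e / (norm x + 1)) * norm x"
      using e by (intro bound) (simp add: add_nonneg_pos)
    also have "\<dots> = C * norm x + e * (norm x / (norm x + 1))"
      by (simp add: distrib_right)
    also have "e * (norm x / (norm x + 1)) \<le> e * 1"
      using e by (intro mult_left_mono) (auto simp: divide_le_eq_1 add_nonneg_pos)
    finally show "norm (apply_op (\<Psi> a) x) \<le> C * norm x + e"
      by simp
  qed
qed

text \<open>If \<open>0 \<le> a \<le> C\<close>, then also \<open>0 \<le> b \<le> C\<close> for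
  \<open>b = C - a\<close>, so \<open>b\<close> is norm bounded by \<open>C\<close>. Contractivity
  gives \<open>\<Psi> b \<le> C\<close>, which is \<open>0 \<le> \<Psi> a\<close> because
  \<open>\<Psi>\<close> is unital.\<close>

lemma map_nonneg:
  assumes a: "a \<in> M" "0 \<le> a"
  shows "0 \<le> \<Psi> a"
proof -
  obtain C where C: "C > 0" "op_bounded C a"
    using ex_op_bounded by blast
  have sa: "adj a = a"
    by (rule nonneg_imp_self_adjoint[OF a(2)])
  define b where "b = complex_of_real C *\<^sub>C 1 - a"
  have bM: "b \<in> M"
    using a by (simp add: b_def closed)
  have bx: "cinner x (apply_op b x) = complex_of_real (C * (norm x)\<^sup>2) - cinner x (apply_op a x)" for x
    by (simp add: b_def apply_op_simps apply_op_scaleC_bop cinner_simps cinner_self)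
  have b: "0 \<le> b"
    unfolding bop_nonneg_iff bx complex_nonneg_Reals_iff
    by (simp add: Re_cinner_le[OF C(2)] self_adjoint_Im_zero[OF sa])
  have Re: "Re (cinner x (apply_op b x)) \<le> C * (norm x)\<^sup>2" for x
    using a(2)[unfolded bop_nonneg_iff complex_nonneg_Reals_iff, rule_format, of x]
    by (simp add: bx)
  have sq: "(norm (apply_op b x))\<^sup>2 \<le> C * Re (cinner x (apply_op b x))" for x
    by (rule nonneg_norm_apply_le[OF b Re])
  have "(norm (apply_op b x))\<^sup>2 \<le> C * (C * (norm x)\<^sup>2)" for x
    by (rule order_trans[OF sq mult_left_mono[OF Re]]) (use C(1) in simp)
  then have "(norm (apply_op b x))\<^sup>2 \<le> (C * norm x)\<^sup>2" for x
    by (simp add: power2_eq_square mult_ac)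
  then have "op_bounded C b"
    unfolding op_bounded_def using C(1) by (intro allI) (rule power2_le_imp_le, simp_all)
  then have \<Psi>b: "op_bounded C (\<Psi> b)"
    using C(1) bM by (intro map_op_bounded) auto
  have "\<Psi> b = complex_of_real C *\<^sub>C 1 - \<Psi> a"
    using a by (simp add: b_def map_diff map_scaleC map_one closed)
  then have "C * (norm x)\<^sup>2 - Re (cinner x (apply_op (\<Psi> a) x)) \<le> C * (norm x)\<^sup>2" for x
    using Re_cinner_le[OF \<Psi>b, of x]
    by (simp add: apply_op_simps apply_op_scaleC_bop cinner_simps cinner_self)
  then have "0 \<le> Re (cinner x (apply_op (\<Psi> a) x))" for x
    by simp
  moreover have "adj (\<Psi> a) = \<Psi> a"
    by (simp only: map_adj[OF a(1), symmetric] sa)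
  from self_adjoint_Im_zero[OF this]
  have "Im (cinner x (apply_op (\<Psi> a) x)) = 0" for x .
  ultimately show ?thesis
    unfolding bop_nonneg_iff complex_nonneg_Reals_iff by blast
qed

lemma map_mono: "\<lbrakk>a \<in> M; b \<in> M; a \<le> b\<rbrakk> \<Longrightarrow> \<Psi> a \<le> \<Psi> b"
  using map_nonneg[of "b - a"] by (simp add: map_diff diff_closed bop_nonneg_diff_iff)

text \<open>Choi's argument: the multiplicativity defect is a positive form by the Schwarz
  inequality, elements of the multiplicative domain are null vectors of it, and a null vector is
  orthogonal to everything.\<close>

lemma multiplicative_domain_mult:
  assumes a: "a \<in> multiplicative_domain M \<Psi>" and b: "b \<in> M"
  shows "\<Psi> (b * a) = \<Psi> b * \<Psi> a"
proof (rule bop_eq_quadraticI)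
  have aM: "a \<in> M"
    using a by (simp add: multiplicative_domain_def)
  fix \<xi>
  interpret B: positive_form M "\<lambda>x y. cinner \<xi> (apply_op (\<Psi> (adj x * y) - adj (\<Psi> x) * \<Psi> y) \<xi>)"
  proof
    fix x y z c
    assume x: "x \<in> M"
    show "cinner \<xi> (apply_op (\<Psi> (adj x * x) - adj (\<Psi> x) * \<Psi> x) \<xi>) \<in> \<real>\<^sub>\<ge>\<^sub>0"
      using map_schwarz'[OF x] by (simp only: less_eq_bop_def)
    assume y: "y \<in> M"
    show "cinner \<xi> (apply_op (\<Psi> (adj x * (c *\<^sub>C y)) - adj (\<Psi> x) * \<Psi> (c *\<^sub>C y)) \<xi>) =
        c * cinner \<xi> (apply_op (\<Psi> (adj x * y) - adj (\<Psi> x) * \<Psi> y) \<xi>)"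
      using x y
      by (simp add: scaleC_mult_right map_scaleC closed apply_op_simps apply_op_scaleC_bop
          cinner_simps right_diff_distrib)
    show "cinner \<xi> (apply_op (\<Psi> (adj (c *\<^sub>C x) * y) - adj (\<Psi> (c *\<^sub>C x)) * \<Psi> y) \<xi>) =
        cnj c * cinner \<xi> (apply_op (\<Psi> (adj x * y) - adj (\<Psi> x) * \<Psi> y) \<xi>)"
      using x y
      by (simp add: scaleC_mult_left adj_scaleC map_scaleC closed apply_op_simps
          apply_op_scaleC_bop apply_op_scaleC cinner_simps right_diff_distrib)
    assume z: "z \<in> M"
    show "cinner \<xi> (apply_op (\<Psi> (adj x * (y + z)) - adj (\<Psi> x) * \<Psi> (y + z)) \<xi>) =
        cinner \<xi> (apply_op (\<Psi> (adj x * y) - adj (\<Psi> x) * \<Psi> y) \<xi>) +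
        cinner \<xi> (apply_op (\<Psi> (adj x * z) - adj (\<Psi> x) * \<Psi> z) \<xi>)"
      using x y z
      by (simp add: distrib_left map_add closed apply_op_simps cinner_simps)
    show "cinner \<xi> (apply_op (\<Psi> (adj (x + y) * z) - adj (\<Psi> (x + y)) * \<Psi> z) \<xi>) =
        cinner \<xi> (apply_op (\<Psi> (adj x * z) - adj (\<Psi> x) * \<Psi> z) \<xi>) +
        cinner \<xi> (apply_op (\<Psi> (adj y * z) - adj (\<Psi> y) * \<Psi> z) \<xi>)"
      using x y z
      by (simp add: distrib_right adj_add map_add closed apply_op_simps cinner_simps)
  qed (auto intro: closed)
  have "\<Psi> (adj a * a) - adj (\<Psi> a) * \<Psi> a = 0"
    using a aM by (simp add: multiplicative_domain_def map_adj)
  then have "B.seminorm a = 0"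
    unfolding B.seminorm_def by (simp add: apply_op_simps)
  then have "cinner \<xi> (apply_op (\<Psi> (adj (adj b) * a) - adj (\<Psi> (adj b)) * \<Psi> a) \<xi>) = 0"
    using B.cauchy_schwarz[OF adj_closed[OF b] aM] by simp
  then show "cinner \<xi> (apply_op (\<Psi> (b * a)) \<xi>) = cinner \<xi> (apply_op (\<Psi> b * \<Psi> a) \<xi>)"
    using b by (simp add: map_adj apply_op_simps cinner_simps)
qed

end

section \<open>Compositions and powers of Schwartz maps\<close>

context von_neumann
begin

lemma unital_schwartz_map_id: "unital_schwartz_map M id"
proof -
  have "a \<le> a" for a :: "'h bop"
    by (simp add: less_eq_bop_iff)
  then show ?thesis
    by (simp add: unital_schwartz_map_def clinear_on_def adj_mult_nonneg)
qed

text \<open>Positivity of Schwartz maps enters here: the outer map has to preserve the Schwarz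
  inequality of the inner one.\<close>

lemma unital_schwartz_map_comp:
  assumes "unital_schwartz_map M \<Psi>" "unital_schwartz_map M \<Theta>"
  shows "unital_schwartz_map M (\<Psi> \<circ> \<Theta>)"
proof -
  interpret P: schwartz_map M \<Psi>
    by unfold_locales (rule assms(1))
  interpret T: schwartz_map M \<Theta>
    by unfold_locales (rule assms(2))
  have "continuous_map (subtopology ultraweak M) (subtopology ultraweak M) (\<Psi> \<circ> \<Theta>)"
    using assms by (intro continuous_map_compose) (auto simp: unital_schwartz_map_def)
  moreover have "0 \<le> \<Psi> (\<Theta> (adj a)) * \<Psi> (\<Theta> a) \<and> \<Psi> (\<Theta> (adj a)) * \<Psi> (\<Theta> a) \<le> \<Psi> (\<Theta> (adj a * a))"
    if a: "a \<in> M" for a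
  proof
    show "0 \<le> \<Psi> (\<Theta> (adj a)) * \<Psi> (\<Theta> a)"
      using P.map_schwarz_nonneg[OF T.maps[OF a]] by (simp add: T.map_adj a)
    have "\<Psi> (adj (\<Theta> a)) * \<Psi> (\<Theta> a) \<le> \<Psi> (\<Theta> (adj a * a))"
    proof (rule bop_le_trans[OF P.map_schwarz[OF T.maps[OF a]]])
      show "\<Psi> (adj (\<Theta> a) * \<Theta> a) \<le> \<Psi> (\<Theta> (adj a * a))"
        using a by (intro P.map_mono T.map_schwarz' closed T.maps)
    qed
    then show "\<Psi> (\<Theta> (adj a)) * \<Psi> (\<Theta> a) \<le> \<Psi> (\<Theta> (adj a * a))"
      by (simp add: T.map_adj a)
  qed
  ultimately show ?thesis
    by (simp add: unital_schwartz_map_def clinear_on_def P.maps T.maps P.map_add T.map_add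
        P.map_scaleC T.map_scaleC P.map_one T.map_one)
qed

lemma unital_schwartz_map_funpow: "unital_schwartz_map M \<Psi> \<Longrightarrow> unital_schwartz_map M (\<Psi> ^^ n)"
  by (induction n) (simp_all add: unital_schwartz_map_id[unfolded id_def] unital_schwartz_map_comp id_def)

end

section \<open>Faithful normal states\<close>

locale faithful_state = von_neumann M for M :: "'h::chilbert_space bop set" +
  fixes \<phi> :: "'h bop \<Rightarrow> complex"
  assumes state_on: "state_on M \<phi>" and normal: "normal_functional M \<phi>" and faithful: "faithful M \<phi>"
begin

lemma phi_add: "\<lbrakk>a \<in> M; b \<in> M\<rbrakk> \<Longrightarrow> \<phi> (a + b) = \<phi> a + \<phi> b"
  and phi_scaleC: "a \<in> M \<Longrightarrow> \<phi> (c *\<^sub>C a) = c * \<phi> a"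
  and phi_nonneg: "\<lbrakk>a \<in> M; 0 \<le> a\<rbrakk> \<Longrightarrow> \<phi> a \<in> \<real>\<^sub>\<ge>\<^sub>0"
  and phi_one: "\<phi> 1 = 1"
  using state_on by (auto simp: state_on_def clinear_on_def scaleC_complex_def)

sublocale phi: positive_form M "\<lambda>a b. \<phi> (adj a * b)"
proof
  fix x assume "x \<in> M"
  then show "\<phi> (adj x * x) \<in> \<real>\<^sub>\<ge>\<^sub>0"
    by (intro phi_nonneg closed adj_mult_nonneg)
qed (simp_all add: closed phi_add phi_scaleC adj_add adj_scaleC distrib_left distrib_right
    scaleC_mult_left scaleC_mult_right)

abbreviation q :: "'h bop \<Rightarrow> real" where
  "q \<equiv> phi.seminorm"

lemma phi_diff: "\<lbrakk>a \<in> M; b \<in> M\<rbrakk> \<Longrightarrow> \<phi> (a - b) = \<phi> a - \<phi> b"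
  using phi.diff_right[of 1 a b] one_closed by simp

lemma phi_adj: "a \<in> M \<Longrightarrow> \<phi> (adj a) = cnj (\<phi> a)"
  using phi.hermitian[OF one_closed, of a] by simp

lemma q_one: "q 1 = 1"
  by (simp add: phi.seminorm_def phi_one)

lemma q_eq_zero: "\<lbrakk>a \<in> M; q a = 0\<rbrakk> \<Longrightarrow> a = 0"
  using faithful phi.form_self[of a] by (simp add: faithful_def)

lemma phi_mult_le: "\<lbrakk>a \<in> M; b \<in> M\<rbrakk> \<Longrightarrow> cmod (\<phi> (a * b)) \<le> q (adj a) * q b"
  using phi.cauchy_schwarz[of "adj a" b] by (simp add: adj_closed)

lemma cmod_phi_le: "a \<in> M \<Longrightarrow> cmod (\<phi> a) \<le> q a"
  using phi_mult_le[of 1 a] by (simp add: one_closed q_one)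

lemma phi_mono: "\<lbrakk>a \<in> M; b \<in> M; a \<le> b\<rbrakk> \<Longrightarrow> Re (\<phi> a) \<le> Re (\<phi> b)"
  using phi_nonneg[of "b - a"]
  by (simp add: diff_closed bop_nonneg_diff_iff phi_diff complex_nonneg_Reals_iff)

text \<open>Faithfulness is only assumed for elements of the form \<open>adj a * a\<close>; instead of taking square
  roots we use \<open>a\<^sup>2 \<le> \<parallel>a\<parallel> a\<close>.\<close>

lemma nonneg_phi_eq_zero:
  assumes a: "a \<in> M" "0 \<le> a" "\<phi> a = 0"
  shows "a = 0"
proof -
  obtain C where C: "C > 0" "op_bounded C a"
    using ex_op_bounded by blast
  have sa: "adj a = a"
    by (rule nonneg_imp_self_adjoint[OF a(2)])
  have aM: "adj a * a \<in> M" "complex_of_real C *\<^sub>C a \<in> M"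
    using a by (auto intro: closed)
  have "adj a * a \<le> complex_of_real C *\<^sub>C a"
    unfolding less_eq_bop_iff complex_nonneg_Reals_iff
  proof
    fix x
    have "(norm (apply_op a x))\<^sup>2 \<le> C * Re (cinner x (apply_op a x))"
      by (rule nonneg_norm_apply_le[OF a(2) Re_cinner_le[OF C(2)]])
    moreover have "cinner x (apply_op (adj a * a) x) = complex_of_real ((norm (apply_op a x))\<^sup>2)"
      by (simp add: apply_op_simps cinner_adj_right cinner_self)
    ultimately show "0 \<le> Re (cinner x (apply_op (complex_of_real C *\<^sub>C a) x) - cinner x (apply_op (adj a * a) x)) \<and>
        Im (cinner x (apply_op (complex_of_real C *\<^sub>C a) x) - cinner x (apply_op (adj a * a) x)) = 0"
      using self_adjoint_Im_zero[OF sa] by (simp add: apply_op_scaleC_bop cinner_scaleC_right)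
  qed
  from phi_mono[OF aM this] have "(q a)\<^sup>2 \<le> 0"
    using a by (simp add: phi_scaleC phi.form_self)
  then show ?thesis
    using q_eq_zero[OF a(1)] by simp
qed

lemma phi_uw_limit: "uw_limit x A U \<Longrightarrow> ((\<lambda>n. \<phi> (x n)) \<longlongrightarrow> \<phi> A) U"
  using continuous_map_limit[of "subtopology ultraweak M" euclidean \<phi> x A U] normal
  by (simp add: normal_functional_def comp_def)

lemma phi_mult_uw_limit:
  assumes "a \<in> M" "\<And>n. x n \<in> M" "uw_limit x A U" "U \<noteq> bot"
  shows "((\<lambda>n. \<phi> (a * x n)) \<longlongrightarrow> \<phi> (a * A)) U"
  by (rule phi_uw_limit[OF uw_limit_mult_left[OF assms]])

text \<open>The bridge between \<open>q\<close> and ultraweak limits. Pairing with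
  \<open>adj a\<close> is continuous in both senses, and the choice \<open>a = A - B\<close> turns
  equality of the two pairings into \<open>\<phi> (adj a * a) = 0\<close>.\<close>

lemma uw_limits_eq:
  assumes x: "\<And>n. x n \<in> M" "uw_limit x A U" and y: "\<And>n. y n \<in> M" "uw_limit y B U"
    and U: "U \<noteq> bot" and zero: "((\<lambda>n. q (x n - y n)) \<longlongrightarrow> 0) U"
  shows "A = B"
proof -
  have AB: "A \<in> M" "B \<in> M"
    using x(2) y(2) uw_limit_mem by auto
  define a where "a = A - B"
  have a: "a \<in> M" "adj a \<in> M"
    using AB by (auto simp: a_def closed)
  have 1: "((\<lambda>n. \<phi> (adj a * x n) - \<phi> (adj a * y n)) \<longlongrightarrow> \<phi> (adj a * A) - \<phi> (adj a * B)) U"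
    by (intro tendsto_diff phi_mult_uw_limit a x y U)
  have "((\<lambda>n. q a * q (x n - y n)) \<longlongrightarrow> 0) U"
    by (rule tendsto_mult_right_zero[OF zero])
  then have "((\<lambda>n. \<phi> (adj a * x n) - \<phi> (adj a * y n)) \<longlongrightarrow> 0) U"
  proof (rule Lim_null_comparison[rotated], intro always_eventually allI)
    fix n
    have "cmod (\<phi> (adj a * (x n - y n))) \<le> q a * q (x n - y n)"
      by (rule phi.cauchy_schwarz[OF a(1) diff_closed[OF x(1) y(1)]])
    then show "cmod (\<phi> (adj a * x n) - \<phi> (adj a * y n)) \<le> q a * q (x n - y n)"
      by (simp add: phi.diff_right[OF a(1) x(1) y(1)])
  qed
  from tendsto_unique[OF U 1 this] have "\<phi> (adj a * a) = 0"
    using phi.diff_right[OF a(1) AB] by (simp add: a_def)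
  then have "a = 0"
    using faithful a(1) by (simp add: faithful_def)
  then show ?thesis
    by (simp add: a_def)
qed

text \<open>Turns statements about cluster points into statements about the whole sequence: if the
  bound failed infinitely often, compactness restricted to the bad indices would yield a cluster
  value of modulus at least \<open>c'\<close>.\<close>

lemma eventually_cmod_less:
  fixes s :: "nat \<Rightarrow> complex"
  assumes x: "\<And>n. x n \<in> M" "\<And>n. op_bounded C (x n)"
    and lim: "\<And>U A. \<lbrakk>U \<le> sequentially; U \<noteq> bot; uw_limit x A U\<rbrakk> \<Longrightarrow> \<exists>l. (s \<longlongrightarrow> l) U \<and> cmod l \<le> c"
    and "c < c'"
  shows "eventually (\<lambda>n. cmod (s n) < c') sequentially"
proof (rule ccontr)
  assume "\<not> ?thesis"
  then have "inf sequentially (principal {n. \<not> cmod (s n) < c'}) \<noteq> bot"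
    unfolding trivial_limit_def eventually_inf_principal by simp
  from bounded_sequence_cluster[of x, OF x this]
  obtain U A where U: "U \<le> inf sequentially (principal {n. \<not> cmod (s n) < c'})" "U \<noteq> bot"
    and A: "uw_limit x A U" .
  obtain l where l: "(s \<longlongrightarrow> l) U" "cmod l \<le> c"
    using lim[OF _ U(2) A] U(1) by auto
  have "eventually (\<lambda>n. n \<in> {n. \<not> cmod (s n) < c'}) U"
    using U(1) by (simp add: le_principal)
  then have "eventually (\<lambda>n. c' \<le> cmod (s n)) U"
    by (simp add: not_less)
  from tendsto_lowerbound[OF tendsto_norm[OF l(1)] this U(2)] show False
    using l(2) \<open>c < c'\<close> by simp
qed

end

section \<open>The reversible part\<close>

locale adjoint_pair = faithful_state M \<phi> + V: schwartz_map M V + W: schwartz_map M W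
  for M :: "'h::chilbert_space bop set" and \<phi> V W +
  assumes adjoint: "\<lbrakk>a \<in> M; b \<in> M\<rbrakk> \<Longrightarrow> \<phi> (b * V a) = \<phi> (W b * a)"
begin

text \<open>Conjugating the adjoint relation exchanges the two maps, so every result about
  \<open>V\<close> has a counterpart for \<open>W\<close>.\<close>

lemma swap: "adjoint_pair M \<phi> W V"
proof
  fix a b assume ab: "a \<in> M" "b \<in> M"
  have "cnj (\<phi> (b * W a)) = \<phi> (W (adj a) * adj b)"
    using ab phi_adj[of "b * W a"] by (simp add: adj_mult W.map_adj W.maps closed)
  also have "\<dots> = \<phi> (adj a * V (adj b))"
    using ab adjoint[of "adj b" "adj a"] by (simp add: closed)
  also have "\<dots> = cnj (\<phi> (V b * a))"
    using ab phi_adj[of "V b * a"] by (simp add: adj_mult V.map_adj V.maps closed)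
  finally show "\<phi> (b * W a) = \<phi> (V b * a)"
    by simp
qed

lemma pair_funpow: "adjoint_pair M \<phi> (V ^^ n) (W ^^ n)"
proof
  show "unital_schwartz_map M (V ^^ n)" "unital_schwartz_map M (W ^^ n)"
    by (rule unital_schwartz_map_funpow V.unital_schwartz_map W.unital_schwartz_map)+
  show "\<phi> (b * (V ^^ n) a) = \<phi> ((W ^^ n) b * a)" if "a \<in> M" "b \<in> M" for a b
    using that
  proof (induction n arbitrary: b)
    case (Suc n)
    have "(V ^^ n) a \<in> M"
      using Suc.prems(1) by (induction n) (simp_all add: V.maps)
    then have "\<phi> (b * (V ^^ Suc n) a) = \<phi> (W b * (V ^^ n) a)"
      using adjoint Suc.prems by simp
    also have "\<dots> = \<phi> ((W ^^ n) (W b) * a)"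
      using Suc.prems by (intro Suc.IH W.maps)
    finally show ?case
      by (simp add: funpow_swap1)
  qed simp
qed

lemma phi_V: "a \<in> M \<Longrightarrow> \<phi> (V a) = \<phi> a"
  using adjoint[of a 1] by (simp add: one_closed W.map_one)

lemma form_V: "\<lbrakk>a \<in> M; b \<in> M\<rbrakk> \<Longrightarrow> \<phi> (adj b * V a) = \<phi> (adj (W b) * a)"
  using adjoint[of a "adj b"] by (simp add: adj_closed W.map_adj)

lemma q_V_le: "a \<in> M \<Longrightarrow> q (V a) \<le> q a"
  using phi_mono[OF _ _ V.map_schwarz'[of a]] phi_V[of "adj a * a"]
  by (simp add: closed V.maps phi.seminorm_def)

text \<open>Expand the square: the cross term equals \<open>(q (V a))\<^sup>2\<close> by
  adjointness, and \<open>q (W (V a)) \<le> q (V a)\<close> by contractivity. Losing little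
  \<open>q\<close> under \<open>V\<close> thus means being nearly fixed by \<open>W\<close> after
  \<open>V\<close>.\<close>

lemma defect:
  assumes a: "a \<in> M"
  shows "(q (W (V a) - a))\<^sup>2 \<le> (q a)\<^sup>2 - (q (V a))\<^sup>2"
proof -
  interpret S: adjoint_pair M \<phi> W V
    by (rule swap)
  have "(q (W (V a) - a))\<^sup>2 = (q (W (V a)))\<^sup>2 - 2 * Re (\<phi> (adj (W (V a)) * a)) + (q a)\<^sup>2"
    using a by (intro phi.seminorm_diff_sq V.maps W.maps)
  also have "\<phi> (adj (W (V a)) * a) = complex_of_real ((q (V a))\<^sup>2)"
    using form_V[OF a V.maps[OF a]] phi.form_self[OF V.maps[OF a]] by simp
  also have "(q (W (V a)))\<^sup>2 \<le> (q (V a))\<^sup>2"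
    using a by (intro power_mono S.q_V_le phi.seminorm_nonneg V.maps W.maps)
  finally show ?thesis
    by simp
qed

lemma fixed_if_isometric:
  assumes a: "a \<in> M" "q a \<le> q (V a)"
  shows "W (V a) = a"
proof -
  have "(q a)\<^sup>2 \<le> (q (V a))\<^sup>2"
    using a by (intro power_mono) auto
  then have "(q (W (V a) - a))\<^sup>2 \<le> 0"
    using defect[OF a(1)] by linarith
  then show ?thesis
    using q_eq_zero[of "W (V a) - a"] a(1) by (simp add: diff_closed V.maps W.maps)
qed

text \<open>Multiplicativity at \<open>adj a * a\<close> and invariance of \<open>\<phi>\<close>
  make \<open>V\<close> isometric at \<open>a\<close>, so the defect vanishes. Conversely, for an
  element fixed by \<open>W\<close> after \<open>V\<close>, the Schwarz defect is a positive
  operator of state zero, hence zero; this applies to \<open>a\<close> and to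
  \<open>adj a\<close>.\<close>

lemma mem_multiplicative_domain_iff:
  "a \<in> multiplicative_domain M V \<longleftrightarrow> a \<in> M \<and> W (V a) = a"
proof
  assume a: "a \<in> multiplicative_domain M V"
  then have aM: "a \<in> M"
    by (simp add: multiplicative_domain_def)
  have "V (adj a * a) = adj (V a) * V a"
    using a V.map_adj[OF aM] by (simp add: multiplicative_domain_def)
  then have "\<phi> (adj (V a) * V a) = \<phi> (adj a * a)"
    using phi_V[of "adj a * a"] aM by (simp add: closed)
  then have "q (V a) = q a"
    by (simp add: phi.seminorm_def)
  then have "W (V a) = a"
    by (intro fixed_if_isometric aM) simp
  with aM show "a \<in> M \<and> W (V a) = a"
    by simp
next
  have key: "V (adj b * b) = V (adj b) * V b" if b: "b \<in> M" "W (V b) = b" for b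
  proof -
    have "\<phi> (V (adj b) * V b) = \<phi> (W (V (adj b)) * b)"
      using b by (intro adjoint V.maps closed)
    also have "W (V (adj b)) = adj b"
      using b by (simp add: V.map_adj W.map_adj V.maps)
    also have "\<phi> (adj b * b) = \<phi> (V (adj b * b))"
      using b phi_V[of "adj b * b"] by (simp add: closed)
    finally have "\<phi> (V (adj b * b) - V (adj b) * V b) = 0"
      using b by (simp add: phi_diff closed V.maps)
    moreover have "0 \<le> V (adj b * b) - V (adj b) * V b"
      using V.map_schwarz[OF b(1)] by (simp add: bop_nonneg_diff_iff)
    ultimately have "V (adj b * b) - V (adj b) * V b = 0"
      using b by (intro nonneg_phi_eq_zero closed V.maps)
    then show ?thesis
      by simp
  qed
  assume a: "a \<in> M \<and> W (V a) = a"
  then have "W (V (adj a)) = adj a"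
    by (simp add: V.map_adj W.map_adj V.maps)
  then show "a \<in> multiplicative_domain M V"
    using key[of a] key[of "adj a"] a by (simp add: multiplicative_domain_def adj_closed)
qed

text \<open>The counterpart inside \<open>M\<close> of the unitary part in the
  Sz.-Nagy--Foias--Langer decomposition of a Hilbert space contraction.\<close>

definition rev_domain :: "'h bop set" where
  "rev_domain = {a \<in> M. \<forall>n. (W ^^ n) ((V ^^ n) a) = a \<and> (V ^^ n) ((W ^^ n) a) = a}"

lemma rev_domain_swap: "adjoint_pair.rev_domain M W V = rev_domain"
  unfolding rev_domain_def adjoint_pair.rev_domain_def[OF swap] by blast

lemma rev_domain_subset: "rev_domain \<subseteq> M"
  by (auto simp: rev_domain_def)

lemma funpow_V_closed: "a \<in> M \<Longrightarrow> (V ^^ n) a \<in> M"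
  by (induction n) (simp_all add: V.maps)

text \<open>Contractivity gives \<open>q (V a) \<le> q a \<le> q ((V ^^ Suc n) a)\<close>, the last
  since \<open>W ^^ Suc n\<close> brings \<open>a\<close> back; so \<open>V ^^ n\<close> is
  isometric at \<open>V a\<close>. In the other order, one factor \<open>W\<close> cancels against
  \<open>V a\<close>.\<close>

lemma rev_domain_V:
  assumes a: "a \<in> rev_domain"
  shows "V a \<in> rev_domain"
proof -
  have aM: "a \<in> M"
    using a rev_domain_subset by blast
  have WV: "(W ^^ n) ((V ^^ n) a) = a" and VW: "(V ^^ n) ((W ^^ n) a) = a" for n
    using a by (auto simp: rev_domain_def)
  have "(W ^^ n) ((V ^^ n) (V a)) = V a" for n
  proof -
    interpret P: adjoint_pair M \<phi> "V ^^ n" "W ^^ n"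
      by (rule pair_funpow)
    interpret Q: adjoint_pair M \<phi> "W ^^ Suc n" "V ^^ Suc n"
      by (rule adjoint_pair.swap[OF pair_funpow])
    have "q (V a) \<le> q a"
      by (rule q_V_le[OF aM])
    also have "q a = q ((W ^^ Suc n) ((V ^^ Suc n) a))"
      by (simp only: WV)
    also have "\<dots> \<le> q ((V ^^ Suc n) a)"
      by (intro Q.q_V_le funpow_V_closed aM)
    also have "(V ^^ Suc n) a = (V ^^ n) (V a)"
      by (simp add: funpow_swap1)
    finally show ?thesis
      by (intro P.fixed_if_isometric V.maps aM)
  qed
  moreover have "(V ^^ n) ((W ^^ n) (V a)) = V a" for n
  proof (cases n)
    case (Suc m)
    have "(W ^^ n) (V a) = (W ^^ m) (W (V a))"
      by (simp add: Suc funpow_swap1)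
    also have "W (V a) = a"
      using WV[of 1] by simp
    finally show ?thesis
      using VW[of m] by (simp add: Suc)
  qed simp
  ultimately show ?thesis
    using aM by (simp add: rev_domain_def V.maps)
qed

lemma rev_domain_funpow_V: "a \<in> rev_domain \<Longrightarrow> (V ^^ n) a \<in> rev_domain"
  by (induction n) (simp_all add: rev_domain_V)

lemma rev_domain_funpow_W: "a \<in> rev_domain \<Longrightarrow> (W ^^ n) a \<in> rev_domain"
  using adjoint_pair.rev_domain_funpow_V[OF swap] by (simp add: rev_domain_swap)

lemma rev_domain_multiplicative:
  assumes "a \<in> M" "b \<in> rev_domain"
  shows "(V ^^ n) (a * b) = (V ^^ n) a * (V ^^ n) b"
proof -
  interpret P: adjoint_pair M \<phi> "V ^^ n" "W ^^ n"
    by (rule pair_funpow)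
  have "b \<in> multiplicative_domain M (V ^^ n)"
    using assms(2) by (simp add: P.mem_multiplicative_domain_iff rev_domain_def)
  then show ?thesis
    using assms(1) by (rule P.V.multiplicative_domain_mult)
qed

text \<open>Both powers are multiplicative when the right factor is reversible, and
  \<open>(V ^^ n) b\<close> is still reversible when \<open>W ^^ n\<close> is applied.\<close>

lemma rev_domain_mult_aux:
  assumes a: "a \<in> rev_domain" and b: "b \<in> rev_domain"
  shows "(W ^^ n) ((V ^^ n) (a * b)) = a * b"
proof -
  have aM: "a \<in> M"
    using a rev_domain_subset by blast
  have "(W ^^ n) ((V ^^ n) (a * b)) = (W ^^ n) ((V ^^ n) a) * (W ^^ n) ((V ^^ n) b)"
    using adjoint_pair.rev_domain_multiplicative[OF swap funpow_V_closed[OF aM],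
        unfolded rev_domain_swap, OF rev_domain_funpow_V[OF b]]
    by (simp only: rev_domain_multiplicative[OF aM b])
  then show ?thesis
    using a b by (simp add: rev_domain_def)
qed

text \<open>The restricted state has its proper value only at members of the reversible algebra, so
  the products inside the correlations have to stay there.\<close>

lemma rev_domain_mult:
  assumes "a \<in> rev_domain" "b \<in> rev_domain"
  shows "a * b \<in> rev_domain"
proof -
  have "a \<in> M" "b \<in> M"
    using assms rev_domain_subset by blast+
  then show ?thesis
    using rev_domain_mult_aux[OF assms]
      adjoint_pair.rev_domain_mult_aux[OF swap, unfolded rev_domain_swap, OF assms]
    by (simp add: rev_domain_def mult_closed)
qed

lemma rev_domain_linear:
  shows rev_domain_add: "\<lbrakk>a \<in> rev_domain; b \<in> rev_domain\<rbrakk> \<Longrightarrow> a + b \<in> rev_domain"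
    and rev_domain_scaleC: "a \<in> rev_domain \<Longrightarrow> c *\<^sub>C a \<in> rev_domain"
    and rev_domain_adj: "a \<in> rev_domain \<Longrightarrow> adj a \<in> rev_domain"
    and rev_domain_one: "1 \<in> rev_domain"
proof -
  have P: "schwartz_map M (V ^^ n)" and Q: "schwartz_map M (W ^^ n)" for n
    using pair_funpow[of n] by (simp_all add: adjoint_pair_def)
  note simps = rev_domain_def closed schwartz_map.maps[OF P] schwartz_map.maps[OF Q]
    schwartz_map.map_add[OF P] schwartz_map.map_add[OF Q] schwartz_map.map_scaleC[OF P]
    schwartz_map.map_scaleC[OF Q] schwartz_map.map_adj[OF P] schwartz_map.map_adj[OF Q]
    schwartz_map.map_one[OF P] schwartz_map.map_one[OF Q]
  show "\<lbrakk>a \<in> rev_domain; b \<in> rev_domain\<rbrakk> \<Longrightarrow> a + b \<in> rev_domain"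
    "a \<in> rev_domain \<Longrightarrow> c *\<^sub>C a \<in> rev_domain"
    "a \<in> rev_domain \<Longrightarrow> adj a \<in> rev_domain" "1 \<in> rev_domain"
    by (simp_all add: simps)
qed

lemma q_funpow_V_le: "a \<in> M \<Longrightarrow> q ((V ^^ n) a) \<le> q a"
  by (rule adjoint_pair.q_V_le[OF pair_funpow])

lemma q_funpow_W_le: "a \<in> M \<Longrightarrow> q ((W ^^ n) a) \<le> q a"
  by (rule adjoint_pair.q_funpow_V_le[OF swap])

lemma form_funpow_V: "\<lbrakk>a \<in> M; b \<in> M\<rbrakk> \<Longrightarrow> \<phi> (adj b * (V ^^ n) a) = \<phi> (adj ((W ^^ n) b) * a)"
  by (rule adjoint_pair.form_V[OF pair_funpow])

lemma orbit_bounded: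
  assumes "a \<in> M" "op_bounded C a" "0 \<le> C"
  shows "op_bounded C ((V ^^ n) a)"
proof -
  interpret P: adjoint_pair M \<phi> "V ^^ n" "W ^^ n"
    by (rule pair_funpow)
  show ?thesis
    by (rule P.V.map_op_bounded[OF assms])
qed

end

section \<open>Ergodicity and weak mixing\<close>

lemma cesaro_shift:
  "1 / of_nat (N + 1) * (\<Sum>k=0..N. f k - c) = 1 / of_nat (N + 1) * (\<Sum>k=0..N. f k) - (c :: complex)"
proof -
  have "(of_nat (N + 1) :: complex) \<noteq> 0"
    by (simp only: of_nat_eq_0_iff)
  then show ?thesis
    by (simp add: sum_subtractf right_diff_distrib del: of_nat_Suc of_nat_add)
qed

text \<open>A uniform error \<open>\<delta>\<close> survives averaging unchanged, while the errors
  of finitely many initial terms add up to a constant \<open>K\<close> that division by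
  \<open>N + 1\<close> removes.\<close>

lemma cesaro_tendsto_zero:
  fixes c :: "nat \<Rightarrow> real"
  assumes nonneg: "\<And>k. 0 \<le> c k"
    and approx: "\<And>\<delta>. \<delta> > 0 \<Longrightarrow> \<exists>g. (\<lambda>N. 1 / real (N + 1) * (\<Sum>k=0..N. g k)) \<longlonglongrightarrow> 0 \<and>
      eventually (\<lambda>k. c k \<le> g k + \<delta>) sequentially"
  shows "(\<lambda>N. 1 / real (N + 1) * (\<Sum>k=0..N. c k)) \<longlonglongrightarrow> 0"
proof (rule order_tendstoI)
  fix \<epsilon> :: real assume "\<epsilon> > 0"
  then obtain g where g: "(\<lambda>N. 1 / real (N + 1) * (\<Sum>k=0..N. g k)) \<longlonglongrightarrow> 0"
      "eventually (\<lambda>k. c k \<le> g k + \<epsilon> / 3) sequentially"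
    using approx[of "\<epsilon> / 3"] by auto
  then obtain n where n: "\<And>k. k \<ge> n \<Longrightarrow> c k \<le> g k + \<epsilon> / 3"
    unfolding eventually_sequentially by blast
  define K where "K = (\<Sum>k<n. \<bar>c k - g k\<bar>)"
  have sum_le: "(\<Sum>k=0..N. c k) \<le> (\<Sum>k=0..N. g k) + real (N + 1) * (\<epsilon> / 3) + K" for N
  proof -
    have "(\<Sum>k=0..N. c k) \<le> (\<Sum>k=0..N. g k + \<epsilon> / 3 + (if k < n then \<bar>c k - g k\<bar> else 0))"
    proof (rule sum_mono)
      fix k
      show "c k \<le> g k + \<epsilon> / 3 + (if k < n then \<bar>c k - g k\<bar> else 0)"
        using n[of k] \<open>\<epsilon> > 0\<close> by (cases "k < n") auto
    qed
    also have "\<dots> = (\<Sum>k=0..N. g k) + real (N + 1) * (\<epsilon> / 3) +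
        (\<Sum>k=0..N. if k < n then \<bar>c k - g k\<bar> else 0)"
      by (simp add: sum.distrib)
    also have "(\<Sum>k=0..N. if k < n then \<bar>c k - g k\<bar> else 0) =
        (\<Sum>k\<in>{0..N} \<inter> {k. k < n}. \<bar>c k - g k\<bar>)"
      by (simp add: sum.inter_restrict)
    also have "\<dots> \<le> K"
      unfolding K_def by (rule sum_mono2) auto
    finally show ?thesis
      by simp
  qed
  have "(\<lambda>N. K * inverse (real (Suc N))) \<longlonglongrightarrow> 0"
    by (rule tendsto_mult_right_zero[OF LIMSEQ_inverse_real_of_nat])
  then have "eventually (\<lambda>N. K * inverse (real (Suc N)) < \<epsilon> / 3) sequentially"
    using \<open>\<epsilon> > 0\<close> by (intro order_tendstoD(2)[where y = 0]) auto
  moreover have "eventually (\<lambda>N. 1 / real (N + 1) * (\<Sum>k=0..N. g k) < \<epsilon> / 3) sequentially"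
    using \<open>\<epsilon> > 0\<close> by (intro order_tendstoD(2)[OF g(1)]) auto
  ultimately show "eventually (\<lambda>N. 1 / real (N + 1) * (\<Sum>k=0..N. c k) < \<epsilon>) sequentially"
  proof eventually_elim
    case (elim N)
    have "1 / real (N + 1) * (\<Sum>k=0..N. c k) \<le>
        1 / real (N + 1) * ((\<Sum>k=0..N. g k) + real (N + 1) * (\<epsilon> / 3) + K)"
      by (intro mult_left_mono sum_le) simp
    also have "\<dots> = 1 / real (N + 1) * (\<Sum>k=0..N. g k) + \<epsilon> / 3 + K * inverse (real (Suc N))"
      unfolding inverse_eq_divide distrib_left by simp
    finally show ?case
      using elim by linarith
  qed
next
  fix \<epsilon> :: real assume "\<epsilon> < 0"
  moreover have "0 \<le> 1 / real (N + 1) * (\<Sum>k=0..N. c k)" for N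
    by (intro mult_nonneg_nonneg sum_nonneg nonneg) simp
  ultimately have "\<epsilon> < 1 / real (N + 1) * (\<Sum>k=0..N. c k)" for N
    by (rule less_le_trans)
  then show "eventually (\<lambda>N. \<epsilon> < 1 / real (N + 1) * (\<Sum>k=0..N. c k)) sequentially"
    by (intro always_eventually allI)
qed

context adjoint_pair
begin

section \<open>Cluster points of orbits\<close>

lemma q_funpow_decseq:
  assumes "a \<in> M"
  shows "decseq (\<lambda>n. q ((V ^^ n) a))"
  by (rule decseq_SucI) (simp add: q_V_le funpow_V_closed[OF assms])

text \<open>At the orbit point \<open>x n\<close>, the defect of the \<open>j\<close>-th powers is
  at most \<open>(q (x n))\<^sup>2 - (q (x (n + j)))\<^sup>2\<close>, and both squares have the same
  limit.\<close>

lemma orbit_defect_tendsto: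
  assumes a: "a \<in> M"
  shows "(\<lambda>n. q ((W ^^ j) ((V ^^ j) ((V ^^ n) a)) - (V ^^ n) a)) \<longlonglongrightarrow> 0"
proof -
  interpret P: adjoint_pair M \<phi> "V ^^ j" "W ^^ j"
    by (rule pair_funpow)
  define x where "x n = (V ^^ n) a" for n
  have x: "x n \<in> M" for n
    by (simp add: x_def funpow_V_closed a)
  have dec: "decseq (\<lambda>n. q (x n))" and nonneg: "0 \<le> q (x n)" for n
    using q_funpow_decseq[OF a] x by (simp_all add: x_def)
  obtain L where L: "(\<lambda>n. q (x n)) \<longlonglongrightarrow> L" and "\<forall>n. L \<le> q (x n)"
    by (rule decseq_convergent[OF dec allI[OF nonneg]])
  from L have "(\<lambda>n. q (x (n + j))) \<longlonglongrightarrow> L"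
    by (rule LIMSEQ_ignore_initial_segment)
  then have "(\<lambda>n. (q (x n))\<^sup>2 - (q (x (n + j)))\<^sup>2) \<longlonglongrightarrow> L\<^sup>2 - L\<^sup>2"
    by (intro tendsto_diff tendsto_power L)
  then have "(\<lambda>n. (q (x n))\<^sup>2 - (q (x (n + j)))\<^sup>2) \<longlonglongrightarrow> 0"
    by simp
  moreover have "norm ((q ((W ^^ j) ((V ^^ j) (x n)) - x n))\<^sup>2) \<le> (q (x n))\<^sup>2 - (q (x (n + j)))\<^sup>2" for n
  proof -
    have "(V ^^ j) (x n) = x (n + j)"
      by (simp add: x_def add.commute[of n] funpow_add)
    then show ?thesis
      using P.defect[OF x[of n]] by simp
  qed
  ultimately have "(\<lambda>n. (q ((W ^^ j) ((V ^^ j) (x n)) - x n))\<^sup>2) \<longlonglongrightarrow> 0"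
    by (rule Lim_null_comparison[OF always_eventually[OF allI], rotated])
  then show ?thesis
    unfolding x_def by simp
qed

text \<open>Foguel's argument: weak cluster points of an orbit of a contraction lie in its unitary part.\<close>

lemma orbit_cluster_mem_rev_domain:
  assumes a: "a \<in> M" and U: "U \<le> sequentially" "U \<noteq> bot"
    and lim: "uw_limit (\<lambda>n. (V ^^ n) a) A U"
  shows "A \<in> rev_domain"
proof -
  note V_closed = funpow_V_closed
  note W_closed = adjoint_pair.funpow_V_closed[OF swap]
  have x: "(V ^^ n) a \<in> M" for n
    by (rule V_closed[OF a])
  have "(W ^^ j) ((V ^^ j) A) = A \<and> (V ^^ j) ((W ^^ j) A) = A" for j
  proof
    interpret P: adjoint_pair M \<phi> "V ^^ j" "W ^^ j"
      by (rule pair_funpow)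
    define d where "d n = (W ^^ j) ((V ^^ j) ((V ^^ n) a)) - (V ^^ n) a" for n
    have d: "(\<lambda>n. q (d n)) \<longlonglongrightarrow> 0"
      unfolding d_def by (rule orbit_defect_tendsto[OF a])
    have dM: "d n \<in> M" for n
      unfolding d_def by (intro diff_closed V_closed W_closed a)
    show "(W ^^ j) ((V ^^ j) A) = A"
    proof (rule uw_limits_eq[OF _ _ _ lim U(2)])
      show "uw_limit (\<lambda>n. (W ^^ j) ((V ^^ j) ((V ^^ n) a))) ((W ^^ j) ((V ^^ j) A)) U"
        by (intro P.W.map_uw_limit P.V.map_uw_limit lim)
      show "((\<lambda>n. q ((W ^^ j) ((V ^^ j) ((V ^^ n) a)) - (V ^^ n) a)) \<longlongrightarrow> 0) U"
        using tendsto_mono[OF U(1) d] by (simp only: d_def)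
    qed (intro V_closed W_closed a)+
    \<comment> \<open>For the opposite order no decreasing quantity is at hand, but \<open>j\<close>
      steps later along the orbit its defect is the image of \<open>d n\<close> under the
      contraction \<open>V ^^ j\<close>.\<close>
    have "(V ^^ j) ((W ^^ j) ((V ^^ (n + j)) a)) - (V ^^ (n + j)) a = (V ^^ j) (d n)" for n
    proof -
      have "(V ^^ (n + j)) a = (V ^^ j) ((V ^^ n) a)"
        by (simp add: add.commute[of n] funpow_add)
      then show ?thesis
        by (simp add: d_def P.V.map_diff V_closed W_closed a)
    qed
    moreover have "(\<lambda>n. q ((V ^^ j) (d n))) \<longlonglongrightarrow> 0"
    proof (rule Lim_null_comparison[OF _ d], intro always_eventually allI)
      fix n
      show "norm (q ((V ^^ j) (d n))) \<le> q (d n)"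
        using q_funpow_V_le[OF dM] phi.seminorm_nonneg[OF V_closed[OF dM]] by simp
    qed
    ultimately have "(\<lambda>n. q ((V ^^ j) ((W ^^ j) ((V ^^ (n + j)) a)) - (V ^^ (n + j)) a)) \<longlonglongrightarrow> 0"
      by simp
    then have e: "(\<lambda>n. q ((V ^^ j) ((W ^^ j) ((V ^^ n) a)) - (V ^^ n) a)) \<longlonglongrightarrow> 0"
      by (rule LIMSEQ_offset)
    show "(V ^^ j) ((W ^^ j) A) = A"
    proof (rule uw_limits_eq[OF _ _ _ lim U(2)])
      show "uw_limit (\<lambda>n. (V ^^ j) ((W ^^ j) ((V ^^ n) a))) ((V ^^ j) ((W ^^ j) A)) U"
        by (intro P.W.map_uw_limit P.V.map_uw_limit lim)
      show "((\<lambda>n. q ((V ^^ j) ((W ^^ j) ((V ^^ n) a)) - (V ^^ n) a)) \<longlongrightarrow> 0) U"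
        by (rule tendsto_mono[OF U(1) e])
    qed (intro V_closed W_closed a)+
  qed
  then show ?thesis
    using uw_limit_mem[OF lim] by (simp add: rev_domain_def)
qed

text \<open>Its orbit is constant, so the element is a cluster point of its own orbit.\<close>

lemma fixed_point_mem_rev_domain:
  assumes "a \<in> M" "V a = a"
  shows "a \<in> rev_domain"
proof (rule orbit_cluster_mem_rev_domain[OF assms(1) order_refl])
  have "(V ^^ n) a = a" for n
    by (induction n) (simp_all add: assms(2))
  then show "uw_limit (\<lambda>n. (V ^^ n) a) a sequentially"
    using assms(1) by simp
qed simp

section \<open>Ergodic averages and ergodicity\<close>

definition avg :: "'h bop \<Rightarrow> nat \<Rightarrow> 'h bop" where
  "avg b N = complex_of_real (1 / real (N + 1)) *\<^sub>C (\<Sum>k=0..N. (V ^^ k) b)"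

lemma orbit_sum_closed: "b \<in> M \<Longrightarrow> (\<Sum>k=0..N. (V ^^ k) b) \<in> M"
  by (induction N) (simp_all add: closed funpow_V_closed V.maps)

lemma avg_closed: "b \<in> M \<Longrightarrow> avg b N \<in> M"
  by (simp add: avg_def scaleC_closed orbit_sum_closed)

lemma avg_bounded:
  assumes b: "b \<in> M" "op_bounded C b" "0 \<le> C"
  shows "op_bounded C (avg b N)"
proof -
  have "op_bounded (real (N + 1) * C) (\<Sum>k=0..N. (V ^^ k) b)"
  proof (induction N)
    case 0
    then show ?case
      using b by simp
  next
    case (Suc N)
    have "op_bounded (real (N + 1) * C + C) ((\<Sum>k=0..N. (V ^^ k) b) + (V ^^ Suc N) b)"
      by (rule op_bounded_add[OF Suc.IH orbit_bounded[OF b]])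
    moreover have "real (N + 1) * C + C = real (Suc N + 1) * C"
      by (simp add: algebra_simps)
    ultimately show ?case
      by (simp only: sum.atLeast0_atMost_Suc)
  qed
  from op_bounded_scaleC[OF this, of "complex_of_real (1 / real (N + 1))"]
  have "op_bounded (cmod (complex_of_real (1 / real (N + 1))) * (real (N + 1) * C)) (avg b N)"
    by (simp only: avg_def)
  moreover have "cmod (complex_of_real (1 / real (N + 1))) * (real (N + 1) * C) = C"
    by (simp only: norm_of_real) (simp add: field_simps)
  ultimately show ?thesis
    by (simp only:)
qed

lemma phi_mult_avg:
  assumes "a \<in> M" "b \<in> M"
  shows "\<phi> (a * avg b N) = 1 / of_nat (N + 1) * (\<Sum>k=0..N. \<phi> (a * (V ^^ k) b))"
proof -
  have "\<phi> (a * (\<Sum>k=0..N. (V ^^ k) b)) = (\<Sum>k=0..N. \<phi> (a * (V ^^ k) b))"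
  proof (induction N)
    case (Suc N)
    have "\<phi> (a * ((\<Sum>k=0..N. (V ^^ k) b) + (V ^^ Suc N) b)) =
        \<phi> (a * (\<Sum>k=0..N. (V ^^ k) b)) + \<phi> (a * (V ^^ Suc N) b)"
      unfolding distrib_left
      by (intro phi_add mult_closed assms orbit_sum_closed funpow_V_closed)
    then show ?case
      by (simp only: sum.atLeast0_atMost_Suc Suc.IH)
  qed simp
  moreover have "\<phi> (a * avg b N) =
      complex_of_real (1 / real (N + 1)) * \<phi> (a * (\<Sum>k=0..N. (V ^^ k) b))"
    unfolding avg_def scaleC_mult_right
    by (intro phi_scaleC mult_closed assms orbit_sum_closed)
  ultimately show ?thesis
    by simp
qed

lemma V_avg_diff:
  assumes b: "b \<in> M"
  shows "V (avg b N) - avg b N = complex_of_real (1 / real (N + 1)) *\<^sub>C ((V ^^ Suc N) b - b)"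
proof -
  have "V (\<Sum>k=0..N. (V ^^ k) b) = (\<Sum>k=0..N. (V ^^ k) b) + ((V ^^ Suc N) b - b)"
  proof (induction N)
    case (Suc N)
    have "V ((\<Sum>k=0..N. (V ^^ k) b) + (V ^^ Suc N) b) =
        V (\<Sum>k=0..N. (V ^^ k) b) + V ((V ^^ Suc N) b)"
      by (intro V.map_add orbit_sum_closed funpow_V_closed b)
    then show ?case
      unfolding sum.atLeast0_atMost_Suc Suc.IH by simp
  qed simp
  then have "V (avg b N) = complex_of_real (1 / real (N + 1)) *\<^sub>C
      ((\<Sum>k=0..N. (V ^^ k) b) + ((V ^^ Suc N) b - b))"
    unfolding avg_def by (simp only: V.map_scaleC[OF orbit_sum_closed[OF b]])
  then show ?thesis
    by (simp only: avg_def scaleC_add_right add_diff_cancel_left')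
qed

text \<open>\<open>V (avg b N) - avg b N\<close> telescopes to two terms over \<open>N + 1\<close>,
  so its seminorm is at most \<open>2 * q b / (N + 1)\<close>.\<close>

lemma avg_cluster_fixed:
  assumes b: "b \<in> M" and U: "U \<le> sequentially" "U \<noteq> bot" and lim: "uw_limit (avg b) A U"
  shows "V A = A"
proof (rule uw_limits_eq[OF _ V.map_uw_limit[OF lim] _ lim U(2)])
  have bound: "norm (q (V (avg b N) - avg b N)) \<le> 2 * q b * inverse (real (Suc N))" for N
  proof -
    have "q ((V ^^ Suc N) b - b) \<le> q ((V ^^ Suc N) b) + q b"
      by (intro phi.seminorm_triangle_diff funpow_V_closed b)
    also have "\<dots> \<le> 2 * q b"
      using q_funpow_V_le[OF b, of "Suc N"] by simp
    finally have "cmod (complex_of_real (1 / real (N + 1))) * q ((V ^^ Suc N) b - b) \<le>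
        cmod (complex_of_real (1 / real (N + 1))) * (2 * q b)"
      by (intro mult_left_mono) auto
    moreover have "q (V (avg b N) - avg b N) =
        cmod (complex_of_real (1 / real (N + 1))) * q ((V ^^ Suc N) b - b)"
      unfolding V_avg_diff[OF b] by (intro phi.seminorm_scale diff_closed funpow_V_closed b)
    moreover have "0 \<le> q (V (avg b N) - avg b N)"
      by (intro phi.seminorm_nonneg diff_closed V.maps avg_closed b)
    moreover have "cmod (complex_of_real (1 / real (N + 1))) = inverse (real (Suc N))"
      by (simp only: norm_of_real) (simp add: field_simps)
    ultimately show ?thesis
      by (simp add: mult.commute)
  qed
  have "(\<lambda>N. 2 * q b * inverse (real (Suc N))) \<longlonglongrightarrow> 0"
    by (rule tendsto_mult_right_zero[OF LIMSEQ_inverse_real_of_nat])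
  then have "(\<lambda>N. q (V (avg b N) - avg b N)) \<longlonglongrightarrow> 0"
    by (rule Lim_null_comparison[OF always_eventually[OF allI[OF bound]]])
  then show "((\<lambda>N. q (V (avg b N) - avg b N)) \<longlongrightarrow> 0) U"
    by (rule tendsto_mono[OF U(1)])
qed (intro V.maps avg_closed b)+

text \<open>\<open>V\<close> and \<open>\<phi>\<close> stay unrestricted, so that only the set of
  test elements differs between the two systems.\<close>

definition ergodic_on :: "'h bop set \<Rightarrow> bool" where
  "ergodic_on S \<longleftrightarrow> (\<forall>a\<in>S. \<forall>b\<in>S.
     (\<lambda>N. 1 / of_nat (N + 1) * (\<Sum>k=0..N. \<phi> (a * (V ^^ k) b) - \<phi> a * \<phi> b)) \<longlonglongrightarrow> 0)"

text \<open>The correlations of \<open>adj A\<close> with the fixed point \<open>A\<close> are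
  constant, so ergodicity forces \<open>\<phi> (adj A * A) = \<phi> (adj A) * \<phi> A\<close>. The
  variance \<open>(q (A - \<phi> A *\<^sub>C 1))\<^sup>2\<close> is then zero, and
  \<open>\<phi>\<close> is faithful.\<close>

lemma fixed_point_scalar:
  assumes erg: "ergodic_on rev_domain" and A: "A \<in> M" "V A = A"
  shows "A = \<phi> A *\<^sub>C 1"
proof -
  have AD: "A \<in> rev_domain"
    by (rule fixed_point_mem_rev_domain[OF A])
  have orbit: "(V ^^ n) A = A" for n
    by (induction n) (simp_all add: A(2))
  let ?c = "\<phi> (adj A * A) - \<phi> (adj A) * \<phi> A"
  have "(\<lambda>N. 1 / of_nat (N + 1) * (\<Sum>k=0..N. \<phi> (adj A * (V ^^ k) A) - \<phi> (adj A) * \<phi> A)) \<longlonglongrightarrow> 0"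
    using erg AD rev_domain_adj[OF AD] unfolding ergodic_on_def by blast
  moreover have "1 / of_nat (N + 1) * (\<Sum>k=0..N. \<phi> (adj A * (V ^^ k) A) - \<phi> (adj A) * \<phi> A) = ?c" for N
  proof -
    have "(of_nat (N + 1) :: complex) \<noteq> 0"
      by (simp only: of_nat_eq_0_iff)
    then show ?thesis
      unfolding orbit by simp
  qed
  ultimately have "?c = 0"
    by (simp only: LIMSEQ_const_iff)
  then have "complex_of_real ((q A)\<^sup>2) = complex_of_real ((cmod (\<phi> A))\<^sup>2)"
    using phi.form_self[OF A(1)] phi_adj[OF A(1)] complex_norm_square[of "\<phi> A"]
    by (simp add: mult.commute)
  then have qA: "(q A)\<^sup>2 = (cmod (\<phi> A))\<^sup>2"
    using of_real_eq_iff by blast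
  have c: "\<phi> A *\<^sub>C 1 \<in> M"
    by (intro scaleC_closed one_closed)
  have "\<phi> (adj A * (\<phi> A *\<^sub>C 1)) = complex_of_real ((cmod (\<phi> A))\<^sup>2)"
    using phi_adj[OF A(1)] complex_norm_square[of "\<phi> A"]
    by (simp add: scaleC_mult_right phi_scaleC adj_closed A(1))
  moreover have "q (\<phi> A *\<^sub>C 1) = cmod (\<phi> A)"
    using phi.seminorm_scale[OF one_closed] by (simp add: q_one)
  ultimately have "(q (A - \<phi> A *\<^sub>C 1))\<^sup>2 = 0"
    using phi.seminorm_diff_sq[OF A(1) c] qA by (simp del: of_real_power)
  then have "A - \<phi> A *\<^sub>C 1 = 0"
    by (intro q_eq_zero diff_closed A c) simp
  then show ?thesis
    by simp
qed

lemma ergodic_on_iff: "ergodic_on M \<longleftrightarrow> ergodic_on rev_domain"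
proof
  assume "ergodic_on M"
  then show "ergodic_on rev_domain"
    using rev_domain_subset unfolding ergodic_on_def by blast
next
  assume erg: "ergodic_on rev_domain"
  show "ergodic_on M"
    unfolding ergodic_on_def
  proof (intro ballI)
    fix a b assume a: "a \<in> M" and b: "b \<in> M"
    obtain C where C: "C > 0" "op_bounded C b"
      using ex_op_bounded by blast
    define s where "s N = \<phi> (a * avg b N) - \<phi> a * \<phi> b" for N
    \<comment> \<open>All cluster values of \<open>s\<close> vanish, so the compactness criterion is
      used with bound 0 and any \<open>\<epsilon> > 0\<close> above it.\<close>
    have "eventually (\<lambda>N. cmod (s N) < \<epsilon>) sequentially" if "\<epsilon> > 0" for \<epsilon>
    proof (rule eventually_cmod_less[of "avg b" C _ 0])
      show "avg b N \<in> M" "op_bounded C (avg b N)" for N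
        using b C by (auto intro: avg_closed avg_bounded)
      fix U A
      assume U: "U \<le> sequentially" "U \<noteq> bot" and lim: "uw_limit (avg b) A U"
      have "A \<in> M"
        by (rule uw_limit_mem[OF lim])
      then have A: "A = \<phi> A *\<^sub>C 1"
        by (rule fixed_point_scalar[OF erg _ avg_cluster_fixed[OF b U lim]])
      have avg: "\<phi> (avg b N) = \<phi> b" for N
      proof -
        have "\<phi> ((V ^^ k) b) = \<phi> b" for k
          by (rule adjoint_pair.phi_V[OF pair_funpow b])
        moreover have "(of_nat (N + 1) :: complex) \<noteq> 0"
          by (simp only: of_nat_eq_0_iff)
        ultimately show ?thesis
          using phi_mult_avg[OF one_closed b, of N] by simp
      qed
      from phi_uw_limit[OF lim, unfolded avg] have "\<phi> A = \<phi> b"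
        using U(2) by (simp add: tendsto_const_iff)
      then have "\<phi> (a * A) = \<phi> a * \<phi> b"
        by (subst A) (simp add: scaleC_mult_right phi_scaleC a)
      moreover have "(s \<longlongrightarrow> \<phi> (a * A) - \<phi> a * \<phi> b) U"
        unfolding s_def
        by (intro tendsto_diff tendsto_const phi_mult_uw_limit[OF a avg_closed[OF b] lim U(2)])
      ultimately show "\<exists>l. (s \<longlongrightarrow> l) U \<and> cmod l \<le> 0"
        by auto
    qed (rule that)
    then have "s \<longlonglongrightarrow> 0"
      by (simp add: tendsto_iff)
    then show "(\<lambda>N. 1 / of_nat (N + 1) * (\<Sum>k=0..N. \<phi> (a * (V ^^ k) b) - \<phi> a * \<phi> b)) \<longlonglongrightarrow> 0"
      unfolding cesaro_shift s_def phi_mult_avg[OF a b] .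
  qed
qed

section \<open>Weak mixing\<close>

lemma orbit_near_orthogonal:
  assumes a: "a \<in> M" and r: "r \<in> M" and \<eta>: "0 \<le> \<eta>"
    and orth: "\<And>d. d \<in> rev_domain \<Longrightarrow> cmod (\<phi> (adj d * r)) \<le> \<eta> * q d"
    and c: "q (adj a) * \<eta> < c"
  shows "eventually (\<lambda>k. cmod (\<phi> (a * (V ^^ k) r)) < c) sequentially"
proof -
  obtain C where C: "C > 0" "op_bounded C r"
    using ex_op_bounded by blast
  show ?thesis
  proof (rule eventually_cmod_less[of "\<lambda>k. (V ^^ k) r" C, OF _ _ _ c])
    show x: "(V ^^ k) r \<in> M" for k
      by (rule funpow_V_closed[OF r])
    show "op_bounded C ((V ^^ k) r)" for k
      using orbit_bounded[OF r C(2)] C(1) by simp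
    fix U A
    assume U: "U \<le> sequentially" "U \<noteq> bot" and lim: "uw_limit (\<lambda>k. (V ^^ k) r) A U"
    have A: "A \<in> rev_domain"
      by (rule orbit_cluster_mem_rev_domain[OF r U lim])
    then have AM: "A \<in> M"
      using rev_domain_subset by blast
    have "((\<lambda>k. cmod (\<phi> (adj A * (V ^^ k) r))) \<longlongrightarrow> cmod (\<phi> (adj A * A))) U"
      by (intro tendsto_norm phi_mult_uw_limit[OF adj_closed[OF AM] x lim U(2)])
    \<comment> \<open>Moving \<open>V ^^ k\<close> to the other side leaves \<open>r\<close> paired
      with \<open>(W ^^ k) A\<close>, which is reversible and no larger than \<open>A\<close>; so
      near orthogonality of \<open>r\<close> holds uniformly along its orbit. In the limit
      \<open>(q A)\<^sup>2 \<le> \<eta> * q A\<close>.\<close>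
    moreover have "cmod (\<phi> (adj A * (V ^^ k) r)) \<le> \<eta> * q A" for k
    proof -
      have "cmod (\<phi> (adj A * (V ^^ k) r)) \<le> \<eta> * q ((W ^^ k) A)"
        unfolding form_funpow_V[OF r AM] by (rule orth[OF rev_domain_funpow_W[OF A]])
      also have "\<dots> \<le> \<eta> * q A"
        by (intro mult_left_mono q_funpow_W_le AM \<eta>)
      finally show ?thesis .
    qed
    then have "eventually (\<lambda>k. cmod (\<phi> (adj A * (V ^^ k) r)) \<le> \<eta> * q A) U"
      by (intro always_eventually allI)
    ultimately have "cmod (\<phi> (adj A * A)) \<le> \<eta> * q A"
      by (rule tendsto_upperbound[OF _ _ U(2)])
    then have sq: "q A * q A \<le> \<eta> * q A"
      by (simp add: phi.form_self[OF AM] norm_power power2_eq_square norm_mult)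
    have "q A \<le> \<eta>"
    proof (cases "q A = 0")
      case False
      then have "0 < q A"
        using phi.seminorm_nonneg[OF AM] by linarith
      then show ?thesis
        by (rule mult_right_le_imp_le[OF sq])
    qed (simp add: \<eta>)
    have "cmod (\<phi> (a * A)) \<le> q (adj a) * q A"
      by (rule phi_mult_le[OF a AM])
    also have "\<dots> \<le> q (adj a) * \<eta>"
      using \<open>q A \<le> \<eta>\<close> by (intro mult_left_mono phi.seminorm_nonneg adj_closed a)
    finally have "cmod (\<phi> (a * A)) \<le> q (adj a) * \<eta>" .
    moreover have "((\<lambda>k. \<phi> (a * (V ^^ k) r)) \<longlongrightarrow> \<phi> (a * A)) U"
      by (rule phi_mult_uw_limit[OF a x lim U(2)])
    ultimately show "\<exists>l. ((\<lambda>k. \<phi> (a * (V ^^ k) r)) \<longlongrightarrow> l) U \<and> cmod l \<le> q (adj a) * \<eta>"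
      by (intro exI conjI)
  qed
qed

lemma near_rev_domain:
  assumes "x \<in> M" "\<eta> > 0"
  obtains e where "e \<in> rev_domain" "\<And>d. d \<in> rev_domain \<Longrightarrow> cmod (\<phi> (adj d * (x - e))) \<le> \<eta> * q d"
proof (rule phi.near_projection[OF rev_domain_subset _ rev_domain_add rev_domain_scaleC assms])
  show "rev_domain \<noteq> {}"
    using rev_domain_one by blast
qed (assumption | rule that)+

definition weakly_mixing_on :: "'h bop set \<Rightarrow> bool" where
  "weakly_mixing_on S \<longleftrightarrow> (\<forall>a\<in>S. \<forall>b\<in>S.
     (\<lambda>N. 1 / real (N + 1) * (\<Sum>k=0..N. cmod (\<phi> (a * (V ^^ k) b) - \<phi> a * \<phi> b))) \<longlonglongrightarrow> 0)"

text \<open>Mixing of the reversible part tests pairs with both entries reversible, so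
  \<open>a\<close> has to be approximated as well as \<open>b\<close>. The remainder of
  \<open>b\<close> is handled by compactness of its orbit, that of \<open>a\<close> directly, since
  the orbit of \<open>e\<close> stays in the reversible algebra.\<close>

lemma weakly_mixing_approx:
  assumes a: "a \<in> M" and b: "b \<in> M" and \<delta>: "\<delta> > 0"
  obtains f e where "f \<in> rev_domain" "e \<in> rev_domain"
    "eventually (\<lambda>k. cmod (\<phi> (a * (V ^^ k) b) - \<phi> a * \<phi> b) \<le>
      cmod (\<phi> (f * (V ^^ k) e) - \<phi> f * \<phi> e) + \<delta>) sequentially"
proof -
  define Q where "Q = q (adj a)"
  have Q: "0 \<le> Q"
    by (simp add: Q_def adj_closed a)
  \<comment> \<open>Half of \<open>\<delta>\<close> pays for the remainder \<open>r\<close> of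
    \<open>b\<close>: its orbit term stays below \<open>Q * \<eta> + \<eta>\<close>, where the extra
    \<open>\<eta>\<close> gives the strict slack that the cluster argument requires, and
    \<open>\<phi> a * \<phi> r\<close> costs \<open>Q * \<eta>\<close>.\<close>
  define \<eta> where "\<eta> = (\<delta> / 2) / (2 * Q + 1)"
  have \<eta>: "\<eta> > 0"
    using \<delta> Q by (simp add: \<eta>_def)
  have "2 * Q + 1 \<noteq> 0"
    using Q by linarith
  then have "(2 * Q + 1) * \<eta> = \<delta> / 2"
    unfolding \<eta>_def by (rule nonzero_mult_div_cancel_left[of _ "\<delta> / 2", unfolded times_divide_eq_right[symmetric]])
  then have \<eta>_eq: "(Q * \<eta> + \<eta>) + Q * \<eta> = \<delta> / 2"
    by (simp add: distrib_right)
  obtain e where e: "e \<in> rev_domain"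
    and e_orth: "\<And>d. d \<in> rev_domain \<Longrightarrow> cmod (\<phi> (adj d * (b - e))) \<le> \<eta> * q d"
    using near_rev_domain[OF b \<eta>] by metis
  have eM: "e \<in> M"
    using e rev_domain_subset by blast
  define r where "r = b - e"
  have r: "r \<in> M"
    using b eM by (simp add: r_def diff_closed)
  \<comment> \<open>The other half pays for the remainder of \<open>adj a\<close>, which costs
    \<open>\<theta> * q e\<close> twice, so \<open>\<theta>\<close> can be fixed only after
    \<open>e\<close>. The added 1 covers \<open>q e = 0\<close>.\<close>
  define \<theta> where "\<theta> = \<delta> / (4 * (q e + 1))"
  have qe: "0 \<le> q e"
    by (simp add: eM)
  have \<theta>: "\<theta> > 0"
    using \<delta> qe by (simp add: \<theta>_def)
  have "2 * (\<theta> * q e) = (\<delta> / 2) * (q e / (q e + 1))"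
    using qe by (simp add: \<theta>_def field_simps)
  also have "\<dots> \<le> (\<delta> / 2) * 1"
    using \<delta> qe by (intro mult_left_mono) auto
  finally have \<theta>_le: "\<theta> * q e + \<theta> * q e \<le> \<delta> / 2"
    by simp
  obtain g where g: "g \<in> rev_domain"
    and g_orth: "\<And>d. d \<in> rev_domain \<Longrightarrow> cmod (\<phi> (adj d * (adj a - g))) \<le> \<theta> * q d"
    using near_rev_domain[OF adj_closed[OF a] \<theta>] by metis
  have gM: "g \<in> M"
    using g rev_domain_subset by blast
  define s where "s = adj a - g"
  have s: "s \<in> M"
    using a gM by (simp add: s_def closed)
  \<comment> \<open>\<open>\<phi> (adj s * d)\<close> is the conjugate of
    \<open>\<phi> (adj d * s)\<close>. Projecting \<open>adj a\<close> instead of \<open>a\<close>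
    puts \<open>s\<close> into the conjugate-linear slot, where the correlations have
    \<open>a\<close>.\<close>
  have s_orth: "cmod (\<phi> (adj s * d)) \<le> \<theta> * q d" if "d \<in> rev_domain" for d
  proof -
    have dM: "d \<in> M"
      using that rev_domain_subset by blast
    show ?thesis
      using g_orth[OF that] phi.hermitian[OF dM s] by (simp add: s_def)
  qed
  have a_eq: "a = adj g + adj s"
    by (simp add: s_def adj_diff)
  have phi_r: "cmod (\<phi> r) \<le> \<eta>"
    using e_orth[OF rev_domain_one] by (simp add: r_def q_one)
  have phi_s: "cmod (\<phi> (adj s)) \<le> \<theta>"
    using s_orth[OF rev_domain_one] by (simp add: q_one)
  have phi_a: "cmod (\<phi> a) \<le> Q"
    using phi_mult_le[OF a one_closed] by (simp add: Q_def q_one)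
  have "eventually (\<lambda>k. cmod (\<phi> (a * (V ^^ k) r)) < Q * \<eta> + \<eta>) sequentially"
  proof (rule orbit_near_orthogonal[OF a r])
    show "0 \<le> \<eta>" "q (adj a) * \<eta> < Q * \<eta> + \<eta>"
      using \<eta> by (simp_all add: Q_def)
  qed (simp add: r_def e_orth)
  then have "eventually (\<lambda>k. cmod (\<phi> (a * (V ^^ k) b) - \<phi> a * \<phi> b) \<le>
      cmod (\<phi> (adj g * (V ^^ k) e) - \<phi> (adj g) * \<phi> e) + \<delta>) sequentially"
  proof (rule eventually_mono)
    fix k
    assume *: "cmod (\<phi> (a * (V ^^ k) r)) < Q * \<eta> + \<eta>"
    interpret P: adjoint_pair M \<phi> "V ^^ k" "W ^^ k"
      by (rule pair_funpow)
    have M: "(V ^^ k) e \<in> M" "(V ^^ k) r \<in> M" "adj g \<in> M" "adj s \<in> M"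
      by (intro funpow_V_closed adj_closed eM r gM s)+
    have "(V ^^ k) b = (V ^^ k) e + (V ^^ k) r"
      using P.V.map_add[OF eM r] by (simp add: r_def)
    then have "\<phi> (a * (V ^^ k) b) = \<phi> (a * (V ^^ k) e) + \<phi> (a * (V ^^ k) r)"
      using phi_add[OF mult_closed[OF a M(1)] mult_closed[OF a M(2)]] by (simp add: distrib_left)
    also have "\<phi> (a * (V ^^ k) e) = \<phi> (adj g * (V ^^ k) e) + \<phi> (adj s * (V ^^ k) e)"
      using phi_add[OF mult_closed[OF M(3,1)] mult_closed[OF M(4,1)]]
      by (simp add: a_eq distrib_right)
    finally have 1: "\<phi> (a * (V ^^ k) b) =
        \<phi> (adj g * (V ^^ k) e) + \<phi> (adj s * (V ^^ k) e) + \<phi> (a * (V ^^ k) r)" .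
    have "\<phi> b = \<phi> e + \<phi> r"
      using phi_add[OF eM r] by (simp add: r_def)
    then have "\<phi> a * \<phi> b = \<phi> a * \<phi> e + \<phi> a * \<phi> r"
      by (simp add: distrib_left)
    also have "\<phi> a * \<phi> e = \<phi> (adj g) * \<phi> e + \<phi> (adj s) * \<phi> e"
      using phi_add[OF M(3,4)] by (simp add: a_eq distrib_right)
    finally have 2: "\<phi> a * \<phi> b = \<phi> (adj g) * \<phi> e + \<phi> (adj s) * \<phi> e + \<phi> a * \<phi> r" .
    have "\<phi> (a * (V ^^ k) b) - \<phi> a * \<phi> b = (\<phi> (adj g * (V ^^ k) e) - \<phi> (adj g) * \<phi> e) +
        ((\<phi> (adj s * (V ^^ k) e) - \<phi> (adj s) * \<phi> e) + (\<phi> (a * (V ^^ k) r) - \<phi> a * \<phi> r))"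
      unfolding 1 2 by simp
    also have "cmod \<dots> \<le> cmod (\<phi> (adj g * (V ^^ k) e) - \<phi> (adj g) * \<phi> e) +
        ((cmod (\<phi> (adj s * (V ^^ k) e)) + cmod (\<phi> (adj s) * \<phi> e)) +
         (cmod (\<phi> (a * (V ^^ k) r)) + cmod (\<phi> a * \<phi> r)))"
      by (rule order_trans[OF norm_triangle_ineq add_left_mono[OF
            order_trans[OF norm_triangle_ineq add_mono[OF norm_triangle_ineq4 norm_triangle_ineq4]]]])
    finally have 3: "cmod (\<phi> (a * (V ^^ k) b) - \<phi> a * \<phi> b) \<le>
        cmod (\<phi> (adj g * (V ^^ k) e) - \<phi> (adj g) * \<phi> e) +
        ((cmod (\<phi> (adj s * (V ^^ k) e)) + cmod (\<phi> (adj s) * \<phi> e)) +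
         (cmod (\<phi> (a * (V ^^ k) r)) + cmod (\<phi> a * \<phi> r)))" .
    have "cmod (\<phi> (adj s * (V ^^ k) e)) \<le> \<theta> * q e"
      using s_orth[OF rev_domain_funpow_V[OF e], of k] mult_left_mono[OF q_funpow_V_le[OF eM, of k], of \<theta>] \<theta>
      by linarith
    moreover have "cmod (\<phi> (adj s) * \<phi> e) \<le> \<theta> * q e"
      unfolding norm_mult using \<theta> phi_s cmod_phi_le[OF eM] by (intro mult_mono) auto
    moreover have "cmod (\<phi> a * \<phi> r) \<le> Q * \<eta>"
      unfolding norm_mult using Q phi_r phi_a by (intro mult_mono) auto
    ultimately show "cmod (\<phi> (a * (V ^^ k) b) - \<phi> a * \<phi> b) \<le>
        cmod (\<phi> (adj g * (V ^^ k) e) - \<phi> (adj g) * \<phi> e) + \<delta>"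
      using 3 * \<theta>_le \<eta>_eq by linarith
  qed
  then show thesis
    by (rule that[OF rev_domain_adj[OF g] e])
qed

lemma weakly_mixing_on_iff: "weakly_mixing_on M \<longleftrightarrow> weakly_mixing_on rev_domain"
proof
  assume "weakly_mixing_on M"
  then show "weakly_mixing_on rev_domain"
    using rev_domain_subset unfolding weakly_mixing_on_def by blast
next
  assume wm: "weakly_mixing_on rev_domain"
  show "weakly_mixing_on M"
    unfolding weakly_mixing_on_def
  proof (intro ballI cesaro_tendsto_zero)
    fix a b and \<delta> :: real
    assume "a \<in> M" "b \<in> M" "\<delta> > 0"
    then obtain f e where fe: "f \<in> rev_domain" "e \<in> rev_domain"
      and ev: "eventually (\<lambda>k. cmod (\<phi> (a * (V ^^ k) b) - \<phi> a * \<phi> b) \<le>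
        cmod (\<phi> (f * (V ^^ k) e) - \<phi> f * \<phi> e) + \<delta>) sequentially"
      by (rule weakly_mixing_approx)
    show "\<exists>g. (\<lambda>N. 1 / real (N + 1) * (\<Sum>k=0..N. g k)) \<longlonglongrightarrow> 0 \<and>
        eventually (\<lambda>k. cmod (\<phi> (a * (V ^^ k) b) - \<phi> a * \<phi> b) \<le> g k + \<delta>) sequentially"
      by (intro exI conjI, rule wm[unfolded weakly_mixing_on_def, rule_format, OF fe], rule ev)
  qed simp
qed

end

section \<open>Passage to the reversible part of the system\<close>

lemma quantum_dynamical_system_adjoint_pair:
  assumes "quantum_dynamical_system M \<Phi> \<phi>"
  shows "adjoint_pair M \<phi> \<Phi> (state_adjoint M \<Phi> \<phi>)"
proof -
  have "\<exists>\<Psi>. is_state_adjoint M \<Phi> \<phi> \<Psi>"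
    using assms by (simp add: quantum_dynamical_system_def)
  then have "is_state_adjoint M \<Phi> \<phi> (state_adjoint M \<Phi> \<phi>)"
    unfolding state_adjoint_def by (rule someI_ex)
  then show ?thesis
    using assms unfolding quantum_dynamical_system_def is_state_adjoint_def
    by unfold_locales auto
qed

theorem proposition7:
  fixes M :: "'h::chilbert_space bop set"
    and \<Phi> :: "'h bop \<Rightarrow> 'h bop"
    and \<phi> :: "'h bop \<Rightarrow> complex"
  assumes "quantum_dynamical_system M \<Phi> \<phi>"
  shows "(ergodic M \<Phi> \<phi> \<longleftrightarrow>
            ergodic (reversible_algebra M \<Phi> \<phi>) (reversible_map M \<Phi> \<phi>) (reversible_state M \<Phi> \<phi>)) \<and>
         (weakly_mixing M \<Phi> \<phi> \<longleftrightarrow>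
            weakly_mixing (reversible_algebra M \<Phi> \<phi>) (reversible_map M \<Phi> \<phi>) (reversible_state M \<Phi> \<phi>))"
proof -
  define W where "W = state_adjoint M \<Phi> \<phi>"
  interpret adjoint_pair M \<phi> \<Phi> W
    unfolding W_def by (rule quantum_dynamical_system_adjoint_pair[OF assms])
  have dom: "a \<in> multiplicative_domain M (\<Phi> ^^ n) \<longleftrightarrow> a \<in> M \<and> (W ^^ n) ((\<Phi> ^^ n) a) = a"
    "a \<in> multiplicative_domain M (W ^^ n) \<longleftrightarrow> a \<in> M \<and> (\<Phi> ^^ n) ((W ^^ n) a) = a" for a n
    by (rule adjoint_pair.mem_multiplicative_domain_iff[OF pair_funpow])
      (rule adjoint_pair.mem_multiplicative_domain_iff[OF adjoint_pair.swap[OF pair_funpow]])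
  have alg: "reversible_algebra M \<Phi> \<phi> = rev_domain"
  proof (intro set_eqI iffI)
    fix a assume a: "a \<in> reversible_algebra M \<Phi> \<phi>"
    have pos: "a \<in> multiplicative_domain M (\<Phi> ^^ n)" for n
      using INT_D[OF a[unfolded reversible_algebra_def] UNIV_I, of "int n"]
      by (simp add: int_iterate_def)
    \<comment> \<open>At \<open>n = 0\<close> the index \<open>- int n\<close> falls into the
      nonnegative branch of \<open>int_iterate\<close>; both zeroth powers are the identity, so
      \<open>pos\<close> covers this case.\<close>
    have neg: "a \<in> multiplicative_domain M (W ^^ n)" for n
      using INT_D[OF a[unfolded reversible_algebra_def] UNIV_I, of "- int n"] pos[of n]
      by (cases "n = 0") (simp_all add: int_iterate_def W_def)
    show "a \<in> rev_domain"
      using pos neg unfolding dom rev_domain_def by blast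
  next
    fix a assume "a \<in> rev_domain"
    then have "a \<in> multiplicative_domain M (\<Phi> ^^ n)" "a \<in> multiplicative_domain M (W ^^ n)" for n
      unfolding dom rev_domain_def by blast+
    then show "a \<in> reversible_algebra M \<Phi> \<phi>"
      by (simp add: reversible_algebra_def int_iterate_def W_def)
  qed
  \<comment> \<open>The restricted map is arbitrary outside the reversible algebra; its iterates
    agree with those of \<open>\<Phi>\<close> because the orbit never leaves.\<close>
  have map: "(reversible_map M \<Phi> \<phi> ^^ k) b = (\<Phi> ^^ k) b" if "b \<in> rev_domain" for b k
    by (induction k) (simp_all add: reversible_map_def alg rev_domain_funpow_V that)
  have state: "reversible_state M \<Phi> \<phi> a = \<phi> a" if "a \<in> rev_domain" for a
    by (simp add: reversible_state_def alg that)
  have terms: "reversible_state M \<Phi> \<phi> (a * (reversible_map M \<Phi> \<phi> ^^ k) b) = \<phi> (a * (\<Phi> ^^ k) b)"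
    if "a \<in> rev_domain" "b \<in> rev_domain" for a b k
    by (simp add: map state rev_domain_mult rev_domain_funpow_V that)
  have "ergodic (reversible_algebra M \<Phi> \<phi>) (reversible_map M \<Phi> \<phi>) (reversible_state M \<Phi> \<phi>)
      \<longleftrightarrow> ergodic_on rev_domain"
    unfolding ergodic_def ergodic_on_def alg by (simp add: terms state cong: ball_cong)
  moreover have "weakly_mixing (reversible_algebra M \<Phi> \<phi>) (reversible_map M \<Phi> \<phi>) (reversible_state M \<Phi> \<phi>)
      \<longleftrightarrow> weakly_mixing_on rev_domain"
    unfolding weakly_mixing_def weakly_mixing_on_def alg by (simp add: terms state cong: ball_cong)
  ultimately show ?thesis
    using ergodic_on_iff weakly_mixing_on_iff
    by (simp add: ergodic_def ergodic_on_def weakly_mixing_def weakly_mixing_on_def)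
qed

end
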